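(* Let $X,B\in\mathbb{R}^{n\times m}$, and let $U,\hat A_{11},Z,W_1,\Lambda,r,s$ be the matrices and integers associated with $X,B$ as defined in the context. Then the minimum Frobenius norm solution of the problem $\inf_{A\in\mathcal{N}_\succeq^n}\|AX-B\|_F^2$ (that is, the matrix of minimum Frobenius norm among all its minimizers) is $$A_\star=U\begin{pmatrix}\hat A_{11}&(Y_\star W_1^\top-Z)^\top\\Z&\frac14Y_\star\Lambda^{-1}Y_\star^\top\end{pmatrix}U^\top,$$ where $Y_\star$ is the unique global minimizer of $$\min_{Y\in\mathbb{R}^{(n-r)\times s}}\|YW_1^\top-Z\|_F^2+\frac1{16}\|Y\Lambda^{-1}Y^\top\|_F^2 .$$ Moreover, the symmetric part $\frac12(A_\star+A_\star^\top)$ has rank $s$, which is the smallest possible rank of the symmetric part of a minimizer of $\inf_{A\in\mathcal{N}_\succeq^n}\|AX-B\|_F^2$, while the skew-symmetric part $\frac12(A_\star-A_\star^\top)$ has rank not greater than $2r$.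
   Context: $\|\cdot\|_F$ is the Frobenius norm. For symmetric matrices, $P\succeq Q$ means that $P-Q$ is (symmetric) positive semidefinite. $\mathcal{N}_\succeq^n=\{A\in\mathbb{R}^{n\times n}:A+A^\top\succeq0\}$. Let $$X=U\Sigma V^\top=\begin{pmatrix}U_1&U_2\end{pmatrix}\begin{pmatrix}\Sigma_1&0\\0&0\end{pmatrix}\begin{pmatrix}V_1&V_2\end{pmatrix}^\top$$ be a singular value decomposition, with $U\in\mathbb{R}^{n\times n}$, $V\in\mathbb{R}^{m\times m}$ orthogonal, $U_1\in\mathbb{R}^{n\times r}$, $V_1\in\mathbb{R}^{m\times r}$, and $\Sigma_1\in\mathbb{R}^{r\times r}$ diagonal with positive diagonal entries, $r=\operatorname{rank}(X)$. Let $\hat A_{11}$ be the (unique) minimizer of $\|A_{11}\Sigma_1-U_1^\top BV_1\|_F^2$ over $A_{11}\in\mathcal{N}_\succeq^r$, let $\hat H_{11}=\frac12(\hat A_{11}+\hat A_{11}^\top)\succeq0$, and let $Z=U_2^\top BV_1\Sigma_1^{-1}\in\mathbb{R}^{(n-r)\times r}$. Let $$\hat H_{11}=\begin{pmatrix}W_1&W_2\end{pmatrix}\begin{pmatrix}\Lambda&0\\0&0\end{pmatrix}\begin{pmatrix}W_1&W_2\end{pmatrix}^\top$$ be a singular value decomposition of $\hat H_{11}$, where $(W_1\ W_2)\in\mathbb{R}^{r\times r}$ is orthogonal, $W_1\in\mathbb{R}^{r\times s}$, $W_2\in\mathbb{R}^{r\times(r-s)}$, $s=\operatorname{rank}(\hat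 H_{11})\le r$, and $\Lambda\in\mathbb{R}^{s\times s}$ is diagonal with positive diagonal entries. *)

theory Defs
  imports "Jordan_Normal_Form.DL_Rank" "Jordan_Normal_Form.Gauss_Jordan_Elimination"
begin

text \<open>All matrices are real and have explicit dimensions; any of them may have no rows or no
  columns, so the degenerate cases \<open>r = 0\<close>, \<open>r = n\<close>, \<open>r = m\<close>, \<open>s = 0\<close>, \<open>s = r\<close> need no special
  treatment.\<close>

definition fro_norm :: "real mat \<Rightarrow> real" where
  "fro_norm A = sqrt (\<Sum>i<dim_row A. \<Sum>j<dim_col A. (A $$ (i, j))\<^sup>2)"

definition psd_mat :: "real mat \<Rightarrow> bool" where
  "psd_mat A \<longleftrightarrow> square_mat A \<and> A\<^sup>T = A
     \<and> (\<forall>x \<in> carrier_vec (dim_row A). 0 \<le> x \<bullet> (A *\<^sub>v x))"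

definition nonsym_psd :: "nat \<Rightarrow> real mat set" where
  "nonsym_psd n = {A \<in> carrier_mat n n. psd_mat (A + A\<^sup>T)}"

definition sym_part :: "real mat \<Rightarrow> real mat" where
  "sym_part A = (1/2) \<cdot>\<^sub>m (A + A\<^sup>T)"

definition skew_part :: "real mat \<Rightarrow> real mat" where
  "skew_part A = (1/2) \<cdot>\<^sub>m (A - A\<^sup>T)"

text \<open>The block matrix \<open>(A B)\<close>; \<open>A\<close> and \<open>B\<close> are meant to have the same number of rows.\<close>

definition hcat :: "real mat \<Rightarrow> real mat \<Rightarrow> real mat" where
  "hcat A B = four_block_mat A B (0\<^sub>m 0 (dim_col A)) (0\<^sub>m 0 (dim_col B))"

text \<open>The library's \<^const>\<open>orthogonal_mat\<close> only asks for nonzero, pairwise orthogonal columns and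
  does not normalise them.\<close>

definition orthonormal_mat :: "nat \<Rightarrow> real mat \<Rightarrow> bool" where
  "orthonormal_mat n U \<longleftrightarrow> U \<in> carrier_mat n n \<and> U\<^sup>T * U = 1\<^sub>m n \<and> U * U\<^sup>T = 1\<^sub>m n"

definition mat_inv :: "real mat \<Rightarrow> real mat" where
  "mat_inv A = the (mat_inverse A)"

lemma mat_inv_eqI:
  assumes A: "A \<in> carrier_mat n n" and B: "B \<in> carrier_mat n n"
    and AB: "A * B = 1\<^sub>m n" and BA: "B * A = 1\<^sub>m n"
  shows "mat_inv A = B"
proof (cases "mat_inverse A")
  case None
  have "A \<in> Units (ring_mat TYPE(real) n ())"
    using A B AB BA by (auto simp: Units_def ring_mat_def)
  with mat_inverse(1)[OF A None, of "()"] show ?thesis by blast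
next
  case (Some C)
  note C = mat_inverse(2)[OF A Some]
  have "C = C * (A * B)" using C AB by (simp add: right_mult_one_mat[of C n n])
  also have "\<dots> = (C * A) * B" using C A B by (metis assoc_mult_mat)
  also have "\<dots> = B" using C B by (simp add: left_mult_one_mat[of B n n])
  finally show ?thesis by (simp add: mat_inv_def Some)
qed

text \<open>Singular value decomposition of an \<open>n \<times> m\<close> matrix of rank \<open>r\<close>, with the positive singular
  values (the diagonal of \<open>S\<close>, in any order) separated from the zero ones.\<close>

definition block_svd ::
  "nat \<Rightarrow> nat \<Rightarrow> nat \<Rightarrow> real mat \<Rightarrow> real mat \<Rightarrow> real mat \<Rightarrow> real mat \<Rightarrow> real mat \<Rightarrow> real mat \<Rightarrow> bool"
where
  "block_svd n m r X U1 U2 S V1 V2 \<longleftrightarrow>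
     X \<in> carrier_mat n m \<and> r = vec_space.rank n X \<and>
     U1 \<in> carrier_mat n r \<and> U2 \<in> carrier_mat n (n - r) \<and> orthonormal_mat n (hcat U1 U2) \<and>
     V1 \<in> carrier_mat m r \<and> V2 \<in> carrier_mat m (m - r) \<and> orthonormal_mat m (hcat V1 V2) \<and>
     S \<in> carrier_mat r r \<and> diagonal_mat S \<and> (\<forall>i<r. 0 < S $$ (i, i)) \<and>
     X = hcat U1 U2
         * four_block_mat S (0\<^sub>m r (m - r)) (0\<^sub>m (n - r) r) (0\<^sub>m (n - r) (m - r))
         * (hcat V1 V2)\<^sup>T"

definition procrustes_solution :: "nat \<Rightarrow> real mat \<Rightarrow> real mat \<Rightarrow> real mat \<Rightarrow> bool" where
  "procrustes_solution n X B =
     is_arg_min (\<lambda>A. (fro_norm (A * X - B))\<^sup>2) (\<lambda>A. A \<in> nonsym_psd n)"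

end

theory Submission
  imports Defs
begin

text \<open>In the coordinates of the singular value decomposition the residual splits into three orthogonal
  parts, and a matrix is a minimizer iff it lies in the cone and its leading block solves the
  \<open>r \<times> r\<close> problem and \<open>A\<^sub>2\<^sub>1 = Z\<close>. Positivity forces \<open>A\<^sub>2\<^sub>1 + A\<^sub>1\<^sub>2\<^sup>T\<close> to vanish on the kernel of \<open>H\<^sub>1\<^sub>1\<close>, i.e. to be \<open>Y W\<^sub>1\<^sup>T\<close>, and
  then forces \<open>P = A\<^sub>2\<^sub>2 - 1/4 Y \<Lambda>\<^sup>-\<^sup>1 Y\<^sup>T\<close> into the cone (Schur complement). Since the inner product
  of \<open>P\<close> with the positive semidefinite \<open>Y \<Lambda>\<^sup>-\<^sup>1 Y\<^sup>T\<close> is nonnegative, the norm is smallest for \<open>P = 0\<close>, which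
  leaves a quartic in \<open>Y\<close>. It is strongly midpoint convex, so minimizing sequences are Cauchy and
  the minimizer exists and is unique. For \<open>P = 0\<close> the symmetric part is \<open>C C\<^sup>T\<close> with
  \<open>C = U\<^sub>1 W\<^sub>1 \<Lambda>\<^sup>1\<^sup>/\<^sup>2 + 1/2 U\<^sub>2 Y \<Lambda>\<^sup>-\<^sup>1\<^sup>/\<^sup>2\<close>, which has \<open>s\<close> columns, while the symmetric part of any
  minimizer compresses to \<open>H\<^sub>1\<^sub>1\<close>, of rank \<open>s\<close>.\<close>

subsection \<open>Rank of products\<close>

context vec_space
begin

text \<open>Rank is the dimension of the column span, so including the columns includes the spans,
  and nested finite-dimensional subspaces have ordered dimensions.\<close>

lemma rank_mono_col_space:
  assumes A: "A \<in> carrier_mat n k" and B: "B \<in> carrier_mat n l"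
    and sub: "set (cols A) \<subseteq> span (set (cols B))"
  shows "rank A \<le> rank B"
proof -
  have cA: "set (cols A) \<subseteq> carrier_vec n" and cB: "set (cols B) \<subseteq> carrier_vec n"
    using A B cols_dim by blast+
  have sA: "subspace class_ring (span (set (cols A))) V"
    and sB: "subspace class_ring (span (set (cols B))) V"
    using cA cB span_is_subspace by auto
  have "span (set (cols A)) \<subseteq> span (set (cols B))"
    using sB by (simp add: span_is_subset sub cB)
  from nested_subspaces[OF sB sA this] show ?thesis
    unfolding rank_def
    using vectorspace.subspace_dim[OF subspace_is_vs[OF sB]]
      fin_dim_span_cols[OF A] fin_dim_span_cols[OF B] by simp
qed

lemma rank_mult_le_left:
  assumes A: "A \<in> carrier_mat n k" and B: "B \<in> carrier_mat k l"
  shows "rank (A * B) \<le> rank A"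
proof (rule rank_mono_col_space)
  show "A * B \<in> carrier_mat n l" "A \<in> carrier_mat n k" using A B by auto
  show "set (cols (A * B)) \<subseteq> span (set (cols A))"
  proof
    fix x assume "x \<in> set (cols (A * B))"
    then obtain j where j: "j < l" and x: "x = col (A * B) j"
      using A B by (auto simp: cols_def)
    have "x = A *\<^sub>v col B j" using x j A B col_mult2 by blast
    then show "x \<in> span (set (cols A))"
      using col_space_eq[OF A] A B j unfolding col_space_def by auto
  qed
qed

text \<open>A maximal independent set of columns forms \<open>C\<close>, and the coordinates of all
  columns in that basis form \<open>D\<close>. The factorization serves to bound the rank of a
  product by that of its right factor.\<close>

lemma rank_factorization:
  assumes A: "A \<in> carrier_mat n l"
  obtains C D where "C \<in> carrier_mat n (rank A)" "D \<in> carrier_mat (rank A) l" "A = C * D"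
proof -
  \<comment> \<open>A maximal independent subset exists because the number of distinct columns
    bounds the sizes.\<close>
  obtain S where S: "maximal S (\<lambda>T. T \<subseteq> set (cols A) \<and> lin_indpt T)"
    using maximal_exists[of "\<lambda>T. T \<subseteq> set (cols A) \<and> lin_indpt T" "card (set (cols A))" "{}"]
    by (meson List.finite_set card_mono empty_iff empty_subsetI finite_lin_indpt2 rev_finite_subset)
  have card: "rank A = card S" by (rule rank_card_indpt[OF A S])
  have Ssub: "S \<subseteq> set (cols A)" and ind: "lin_indpt S" using S by (auto simp: maximal_def)
  have cA: "set (cols A) \<subseteq> carrier_vec n" using A cols_dim by blast
  have fin: "finite S" using Ssub finite_subset by blast
  \<comment> \<open>A column outside the span could be adjoined to \<open>S\<close> without losing
    independence, against maximality.\<close>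
  have in_span: "x \<in> span S" if x: "x \<in> set (cols A)" for x
  proof (rule ccontr)
    assume n: "x \<notin> span S"
    have "x \<notin> S" using n Ssub cA by (meson in_own_span subset_trans subset_iff)
    moreover have "lin_indpt (S \<union> {x})"
      using lin_dep_iff_in_span[of S x] n ind x Ssub cA calculation by auto
    moreover have "S \<union> {x} \<subseteq> set (cols A)" using Ssub x by auto
    ultimately show False using S unfolding maximal_def by blast
  qed
  obtain ws where ws: "set ws = S" "distinct ws" using finite_distinct_list[OF fin] by blast
  define C where "C = mat_of_cols n ws"
  have len: "length ws = rank A" using ws card distinct_card by fastforce
  have C: "C \<in> carrier_mat n (rank A)" unfolding C_def len[symmetric] by simp
  have colsC: "cols C = ws" unfolding C_def using ws Ssub cA by (simp add: cols_mat_of_cols)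
  have "\<exists>v \<in> carrier_vec (rank A). C *\<^sub>v v = col A j" if j: "j < l" for j
  proof -
    have "col A j \<in> set (cols A)" using j A by (auto simp: cols_def)
    then have "col A j \<in> col_space C" using in_span ws unfolding col_space_def colsC by auto
    then show ?thesis using col_space_eq[OF C] C by auto
  qed
  then obtain f where f: "\<And>j. j < l \<Longrightarrow> f j \<in> carrier_vec (rank A) \<and> C *\<^sub>v f j = col A j"
    by metis
  define D where "D = mat_of_cols (rank A) (map f [0..<l])"
  have D: "D \<in> carrier_mat (rank A) l" unfolding D_def using mat_of_cols_carrier(1)[of "rank A" "map f [0..<l]"] by simp
  have "A = C * D"
  proof (rule mat_col_eqI)
    fix j assume "j < dim_col (C * D)"
    then have j: "j < l" using D by simp
    have "col D j = f j" unfolding D_def using f[OF j] j by (simp add: col_mat_of_cols)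
    then show "col A j = col (C * D) j" using f[OF j] col_mult2[OF C D j] by simp
  qed (use A C D in auto)
  with C D that show thesis by blast
qed

lemma rank_mult_le_dim:
  assumes "A \<in> carrier_mat n k" "B \<in> carrier_mat k l"
  shows "rank (A * B) \<le> k"
  using rank_mult_le_left[OF assms] rank_le_nc[OF assms(1)] by simp

end

text \<open>Once \<open>B = C * D\<close> passes through the inner dimension \<open>rank B\<close>,
  the product \<open>(A * C) * D\<close> passes through the same dimension.\<close>

lemma rank_mult_le_right:
  assumes A: "A \<in> carrier_mat n k" and B: "B \<in> carrier_mat k l"
  shows "vec_space.rank n (A * B) \<le> vec_space.rank k (B :: 'a :: field mat)"
proof -
  obtain C D where C: "C \<in> carrier_mat k (vec_space.rank k B)"
    and D: "D \<in> carrier_mat (vec_space.rank k B) l" and B_eq: "B = C * D"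
    by (rule vec_space.rank_factorization[OF B])
  have "A * B = (A * C) * D" unfolding B_eq by (rule assoc_mult_mat[OF A C D, symmetric])
  then show ?thesis using vec_space.rank_mult_le_dim[of "A * C" n _ D l] A C D by auto
qed

subsection \<open>Matrix algebra with dimension side conditions\<close>

context
  fixes A B C :: "'a :: comm_ring_1 mat"
begin

text \<open>In this family the side conditions are equations between dimensions instead of carrier
  memberships, so each is settled by computing dimensions.\<close>

lemma mult_assoc_dim: "dim_col A = dim_row B \<Longrightarrow> dim_col B = dim_row C \<Longrightarrow> A * B * C = A * (B * C)"
  by (rule assoc_mult_mat[of A _ "dim_row B" B "dim_row C" C]) auto

lemma transpose_mult_dim: "dim_col A = dim_row B \<Longrightarrow> (A * B)\<^sup>T = B\<^sup>T * A\<^sup>T"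
  by (rule transpose_mult[of A _ "dim_row B" B]) auto

lemma add_mult_dim:
  "dim_row A = dim_row B \<Longrightarrow> dim_col A = dim_col B \<Longrightarrow> dim_col B = dim_row C \<Longrightarrow>
    (A + B) * C = A * C + B * C"
  by (rule add_mult_distrib_mat[of A "dim_row B" "dim_row C" B C]) auto

lemma mult_add_dim:
  "dim_col A = dim_row B \<Longrightarrow> dim_row B = dim_row C \<Longrightarrow> dim_col B = dim_col C \<Longrightarrow>
    A * (B + C) = A * B + A * C"
  by (rule mult_add_distrib_mat[of A _ "dim_row C" B "dim_col C" C]) auto

lemma minus_mult_dim:
  "dim_row A = dim_row B \<Longrightarrow> dim_col A = dim_col B \<Longrightarrow> dim_col B = dim_row C \<Longrightarrow>
    (A - B) * C = A * C - B * C"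
  by (rule minus_mult_distrib_mat[of A "dim_row B" "dim_row C" B C]) auto

lemma mult_minus_dim:
  "dim_col A = dim_row B \<Longrightarrow> dim_row B = dim_row C \<Longrightarrow> dim_col B = dim_col C \<Longrightarrow>
    A * (B - C) = A * B - A * C"
  by (rule mult_minus_distrib_mat[of A _ "dim_row C" B "dim_col C" C]) auto

lemma smult_mult_dim: "dim_col A = dim_row B \<Longrightarrow> (k \<cdot>\<^sub>m A) * B = k \<cdot>\<^sub>m (A * B)"
  by (rule mult_smult_assoc_mat[of A _ "dim_row B" B]) auto

lemma mult_smult_dim: "dim_col A = dim_row B \<Longrightarrow> A * (k \<cdot>\<^sub>m B) = k \<cdot>\<^sub>m (A * B)"
  by (rule mult_smult_distrib[of A _ "dim_row B" B]) auto

lemma transpose_add_dim: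
  "dim_row A = dim_row B \<Longrightarrow> dim_col A = dim_col B \<Longrightarrow> (A + B)\<^sup>T = A\<^sup>T + B\<^sup>T"
  by (rule eq_matI) auto

lemma transpose_minus_dim:
  "dim_row A = dim_row B \<Longrightarrow> dim_col A = dim_col B \<Longrightarrow> (A - B)\<^sup>T = A\<^sup>T - B\<^sup>T"
  by (rule eq_matI) auto

lemma transpose_smult_dim: "(k \<cdot>\<^sub>m A)\<^sup>T = k \<cdot>\<^sub>m A\<^sup>T"
  by (rule eq_matI) auto

lemma mult_one_dim: "dim_col A = n \<Longrightarrow> A * 1\<^sub>m n = A"
  by (rule right_mult_one_mat[of A "dim_row A"]) auto

lemma one_mult_dim: "dim_row A = n \<Longrightarrow> 1\<^sub>m n * A = A"
  by (rule left_mult_one_mat[of A _ "dim_col A"]) auto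

lemma mult_zero_dim: "dim_col A = p \<Longrightarrow> A * 0\<^sub>m p q = 0\<^sub>m (dim_row A) q"
  by (rule right_mult_zero_mat[of A "dim_row A"]) auto

lemma zero_mult_dim: "dim_row A = q \<Longrightarrow> 0\<^sub>m p q * A = 0\<^sub>m p (dim_col A)"
  by (rule left_mult_zero_mat[of A _ "dim_col A"]) auto

lemma add_zero_dim: "dim_row A = p \<Longrightarrow> dim_col A = q \<Longrightarrow> A + 0\<^sub>m p q = A"
  by (rule eq_matI) auto

lemma zero_add_dim: "dim_row A = p \<Longrightarrow> dim_col A = q \<Longrightarrow> 0\<^sub>m p q + A = A"
  by (rule eq_matI) auto

lemma smult_add_dim:
  "dim_row A = dim_row B \<Longrightarrow> dim_col A = dim_col B \<Longrightarrow> k \<cdot>\<^sub>m (A + B) = k \<cdot>\<^sub>m A + k \<cdot>\<^sub>m B"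
  by (rule eq_matI) (auto simp: algebra_simps)

lemma smult_minus_dim:
  "dim_row A = dim_row B \<Longrightarrow> dim_col A = dim_col B \<Longrightarrow> k \<cdot>\<^sub>m (A - B) = k \<cdot>\<^sub>m A - k \<cdot>\<^sub>m B"
  by (rule eq_matI) (auto simp: algebra_simps)

lemma smult_smult_dim: "k \<cdot>\<^sub>m (l \<cdot>\<^sub>m A) = (k * l) \<cdot>\<^sub>m A"
  by (rule eq_matI) auto

end

lemmas mat_dim_simps = mult_assoc_dim transpose_mult_dim add_mult_dim mult_add_dim minus_mult_dim
  mult_minus_dim smult_mult_dim mult_smult_dim transpose_add_dim transpose_minus_dim
  transpose_smult_dim mult_one_dim one_mult_dim mult_zero_dim zero_mult_dim add_zero_dim
  zero_add_dim smult_add_dim smult_minus_dim smult_smult_dim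

text \<open>Products are normalised to the right, so a factor such as \<open>U\<^sub>1\<^sup>T * U\<^sub>1\<close> is visible only as
  \<open>U\<^sub>1\<^sup>T * (U\<^sub>1 * C)\<close>.\<close>

lemma mult_assoc_rewrite:
  assumes "A * B = (E :: 'a :: comm_ring_1 mat)" "dim_col A = dim_row B" "dim_col B = dim_row C"
  shows "A * (B * C) = E * C"
  using mult_assoc_dim[of A B C] assms by simp

subsection \<open>The Frobenius inner product\<close>

text \<open>The trace inner product tr(A^T B). Both index ranges come from the first argument, which
  is why symmetry and the laws for the second argument carry dimension conditions.\<close>

definition frob_inner :: "real mat \<Rightarrow> real mat \<Rightarrow> real" where
  "frob_inner A B = (\<Sum>i<dim_row A. \<Sum>j<dim_col A. A $$ (i, j) * B $$ (i, j))"

lemma fro_norm_sq: "(fro_norm A)\<^sup>2 = frob_inner A A"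
  unfolding fro_norm_def frob_inner_def
  by (subst real_sqrt_pow2) (auto intro!: sum_nonneg simp: power2_eq_square)

lemma fro_norm_nonneg: "0 \<le> fro_norm A"
  unfolding fro_norm_def by (auto intro!: sum_nonneg)

lemma fro_norm_le_iff: "fro_norm A \<le> fro_norm B \<longleftrightarrow> frob_inner A A \<le> frob_inner B B"
  unfolding fro_norm_sq[symmetric]
  using power_mono_iff[of "fro_norm A" "fro_norm B" 2] by (simp add: fro_norm_nonneg)

lemma frob_inner_self_nonneg: "0 \<le> frob_inner A A"
  unfolding frob_inner_def by (auto intro!: sum_nonneg)

lemma frob_inner_self_eq_0:
  assumes "frob_inner A A = 0"
  shows "A = 0\<^sub>m (dim_row A) (dim_col A)"
proof (rule eq_matI)
  fix i j assume "i < dim_row (0\<^sub>m (dim_row A) (dim_col A) :: real mat)"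
    "j < dim_col (0\<^sub>m (dim_row A) (dim_col A) :: real mat)"
  then have ij: "i < dim_row A" "j < dim_col A" by auto
  have "\<forall>i\<in>{..<dim_row A}. (\<Sum>j<dim_col A. A $$ (i, j) * A $$ (i, j)) = 0"
    using assms unfolding frob_inner_def by (subst (asm) sum_nonneg_eq_0_iff) (auto intro: sum_nonneg)
  then have "(\<Sum>j<dim_col A. A $$ (i, j) * A $$ (i, j)) = 0" using ij by auto
  then have "\<forall>j\<in>{..<dim_col A}. A $$ (i, j) * A $$ (i, j) = 0"
    by (subst (asm) sum_nonneg_eq_0_iff) auto
  then show "A $$ (i, j) = 0\<^sub>m (dim_row A) (dim_col A) $$ (i, j)" using ij by auto
qed auto

lemma frob_inner_commute:
  "dim_row A = dim_row B \<Longrightarrow> dim_col A = dim_col B \<Longrightarrow> frob_inner A B = frob_inner B A"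
  unfolding frob_inner_def by (simp add: mult.commute)

lemma frob_inner_add_left:
  "dim_row A = dim_row B \<Longrightarrow> dim_col A = dim_col B \<Longrightarrow>
    frob_inner (A + B) C = frob_inner A C + frob_inner B C"
  unfolding frob_inner_def by (simp add: distrib_right sum.distrib)

lemma frob_inner_add_right:
  "dim_row A = dim_row B \<Longrightarrow> dim_col A = dim_col B \<Longrightarrow> dim_row B = dim_row C \<Longrightarrow>
    dim_col B = dim_col C \<Longrightarrow> frob_inner C (A + B) = frob_inner C A + frob_inner C B"
  unfolding frob_inner_def by (simp add: distrib_left sum.distrib)

lemma frob_inner_minus_left:
  "dim_row A = dim_row B \<Longrightarrow> dim_col A = dim_col B \<Longrightarrow>
    frob_inner (A - B) C = frob_inner A C - frob_inner B C"
  unfolding frob_inner_def by (simp add: left_diff_distrib sum_subtractf)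

lemma frob_inner_minus_right:
  "dim_row A = dim_row B \<Longrightarrow> dim_col A = dim_col B \<Longrightarrow> dim_row B = dim_row C \<Longrightarrow>
    dim_col B = dim_col C \<Longrightarrow> frob_inner C (A - B) = frob_inner C A - frob_inner C B"
  unfolding frob_inner_def by (simp add: right_diff_distrib sum_subtractf)

lemma frob_inner_smult_left: "frob_inner (k \<cdot>\<^sub>m A) B = k * frob_inner A B"
  unfolding frob_inner_def by (simp add: sum_distrib_left mult.assoc)

lemma frob_inner_smult_right:
  "dim_row A = dim_row B \<Longrightarrow> dim_col A = dim_col B \<Longrightarrow>
    frob_inner A (k \<cdot>\<^sub>m B) = k * frob_inner A B"
  unfolding frob_inner_def by (simp add: sum_distrib_left mult.left_commute)

lemma frob_inner_zero_left [simp]: "frob_inner (0\<^sub>m p q) B = 0"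
  unfolding frob_inner_def by simp

lemma frob_inner_zero_right: "dim_row A = p \<Longrightarrow> dim_col A = q \<Longrightarrow> frob_inner A (0\<^sub>m p q) = 0"
  unfolding frob_inner_def by simp

lemmas frob_inner_simps = frob_inner_add_left frob_inner_add_right frob_inner_minus_left
  frob_inner_minus_right frob_inner_smult_left frob_inner_smult_right frob_inner_zero_right

lemma frob_inner_transpose:
  "dim_row A = dim_row B \<Longrightarrow> dim_col A = dim_col B \<Longrightarrow> frob_inner (A\<^sup>T) (B\<^sup>T) = frob_inner A B"
  unfolding frob_inner_def by (simp add: sum.swap[of _ "{..<dim_col B}"])

text \<open>Both sides expand to one triple sum; three exchanges bring the row index of
  \<open>P\<close> innermost. This adjoint rule and its right-hand counterpart are what move
  orthonormal factors across the inner product.\<close>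

lemma frob_inner_mult_left:
  assumes "dim_col P = dim_row A" "dim_row P = dim_row B" "dim_col A = dim_col B"
  shows "frob_inner (P * A) B = frob_inner A (P\<^sup>T * B)"
proof -
  have "frob_inner (P * A) B =
    (\<Sum>i<dim_row P. \<Sum>j<dim_col A. \<Sum>k<dim_row A. P $$ (i, k) * A $$ (k, j) * B $$ (i, j))"
    unfolding frob_inner_def using assms by (simp add: scalar_prod_def sum_distrib_right atLeast0LessThan)
  also have "\<dots> = (\<Sum>i<dim_row P. \<Sum>k<dim_row A. \<Sum>j<dim_col A. P $$ (i, k) * A $$ (k, j) * B $$ (i, j))"
    by (rule sum.cong[OF refl]) (rule sum.swap)
  also have "\<dots> = (\<Sum>k<dim_row A. \<Sum>i<dim_row P. \<Sum>j<dim_col A. P $$ (i, k) * A $$ (k, j) * B $$ (i, j))"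
    by (rule sum.swap)
  also have "\<dots> = (\<Sum>k<dim_row A. \<Sum>j<dim_col A. \<Sum>i<dim_row P. P $$ (i, k) * A $$ (k, j) * B $$ (i, j))"
    by (rule sum.cong[OF refl]) (rule sum.swap)
  also have "\<dots> = frob_inner A (P\<^sup>T * B)"
    unfolding frob_inner_def using assms
    by (simp add: scalar_prod_def sum_distrib_left atLeast0LessThan ac_simps)
  finally show ?thesis .
qed

lemma frob_inner_mult_right:
  assumes "dim_col A = dim_row Q" "dim_row A = dim_row B" "dim_col Q = dim_col B"
  shows "frob_inner (A * Q) B = frob_inner A (B * Q\<^sup>T)"
proof -
  have "frob_inner (A * Q) B = frob_inner (Q\<^sup>T * A\<^sup>T) (B\<^sup>T)"
    using frob_inner_transpose[of "A * Q" B] assms by (simp add: transpose_mult_dim)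
  also have "\<dots> = frob_inner (A\<^sup>T) (Q * B\<^sup>T)"
    using frob_inner_mult_left[of "Q\<^sup>T" "A\<^sup>T" "B\<^sup>T"] assms by simp
  also have "\<dots> = frob_inner A (B * Q\<^sup>T)"
    using frob_inner_transpose[of A "B * Q\<^sup>T"] assms by (simp add: transpose_mult_dim)
  finally show ?thesis .
qed

section \<open>The cone in terms of matrix test directions\<close>

lemma frob_inner_eq_sum_cols:
  assumes "M \<in> carrier_mat n n" "G \<in> carrier_mat n k"
  shows "frob_inner G (M * G) = (\<Sum>j<k. col G j \<bullet> (M *\<^sub>v col G j))"
proof -
  have "frob_inner G (M * G) = (\<Sum>j<k. \<Sum>i<n. G $$ (i, j) * (M * G) $$ (i, j))"
    unfolding frob_inner_def using assms by (simp add: sum.swap[of _ "{..<k}"])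
  also have "\<dots> = (\<Sum>j<k. col G j \<bullet> (M *\<^sub>v col G j))"
    using assms by (intro sum.cong[OF refl]) (simp add: scalar_prod_def[of "col G _" "_ *\<^sub>v _"] atLeast0LessThan)
  finally show ?thesis .
qed

text \<open>By adjointness and symmetry of the inner product the transpose contributes as much as
  \<open>A\<close> itself, so the cone can be tested on \<open>A\<close> instead of
  \<open>A + A\<^sup>T\<close>.\<close>

lemma frob_inner_sym_part:
  assumes "A \<in> carrier_mat n n" "G \<in> carrier_mat n k"
  shows "frob_inner G ((A + A\<^sup>T) * G) = 2 * frob_inner G (A * G)"
proof -
  have "frob_inner G (A\<^sup>T * G) = frob_inner (A * G) G"
    using frob_inner_mult_left[of A G G] assms by simp
  also have "\<dots> = frob_inner G (A * G)" using assms by (intro frob_inner_commute) auto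
  finally show ?thesis using assms by (simp add: add_mult_dim frob_inner_add_right)
qed

text \<open>Testing with matrices \<open>G\<close> rather than vectors keeps all later computations inside matrix
  algebra.\<close>

lemma nonsym_psd_iff:
  "A \<in> nonsym_psd n \<longleftrightarrow>
    A \<in> carrier_mat n n \<and> (\<forall>k. \<forall>G \<in> carrier_mat n k. 0 \<le> frob_inner G (A * G))"
proof (intro iffI conjI allI ballI)
  assume "A \<in> nonsym_psd n"
  then show A: "A \<in> carrier_mat n n" by (simp add: nonsym_psd_def)
  fix k and G :: "real mat" assume G: "G \<in> carrier_mat n k"
  have "0 \<le> col G j \<bullet> ((A + A\<^sup>T) *\<^sub>v col G j)" if "j < k" for j
    using \<open>A \<in> nonsym_psd n\<close> A G that by (auto simp: nonsym_psd_def psd_mat_def)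
  then have "0 \<le> frob_inner G ((A + A\<^sup>T) * G)"
    using frob_inner_eq_sum_cols[of "A + A\<^sup>T" n G k] A G by (auto intro: sum_nonneg)
  then show "0 \<le> frob_inner G (A * G)" using frob_inner_sym_part[OF A G] by simp
next
  assume *: "A \<in> carrier_mat n n \<and> (\<forall>k. \<forall>G \<in> carrier_mat n k. 0 \<le> frob_inner G (A * G))"
  then have A: "A \<in> carrier_mat n n" by blast
  have "0 \<le> x \<bullet> ((A + A\<^sup>T) *\<^sub>v x)" if x: "x \<in> carrier_vec n" for x
  proof -
    \<comment> \<open>A one-column test matrix recovers the vector inequality.\<close>
    define G where "G = mat_of_cols n [x]"
    have G: "G \<in> carrier_mat n 1" unfolding G_def using mat_of_cols_carrier(1)[of n "[x]"] by simp
    have "col G 0 = x" unfolding G_def using x by (simp add: col_mat_of_cols)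
    then have "frob_inner G ((A + A\<^sup>T) * G) = x \<bullet> ((A + A\<^sup>T) *\<^sub>v x)"
      using frob_inner_eq_sum_cols[of "A + A\<^sup>T" n G 1] A G by simp
    then show ?thesis using * frob_inner_sym_part[OF A G] G by fastforce
  qed
  moreover have "(A + A\<^sup>T)\<^sup>T = A + A\<^sup>T" using A by (auto simp: comm_add_mat transpose_add_dim)
  ultimately show "A \<in> nonsym_psd n" using A by (auto simp: nonsym_psd_def psd_mat_def)
qed

lemma nonsym_psdD:
  "A \<in> nonsym_psd n \<Longrightarrow> G \<in> carrier_mat n k \<Longrightarrow> 0 \<le> frob_inner G (A * G)"
  by (simp add: nonsym_psd_iff)

lemma nonsym_psd_carrier: "A \<in> nonsym_psd n \<Longrightarrow> A \<in> carrier_mat n n"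
  by (simp add: nonsym_psd_iff)

text \<open>Substitute the test matrix \<open>P * G\<close>. With \<open>P = U1\<close> this puts
  the leading block of a feasible matrix into the smaller cone.\<close>

lemma nonsym_psd_congruence:
  assumes A: "A \<in> nonsym_psd n" and P: "P \<in> carrier_mat n k"
  shows "P\<^sup>T * A * P \<in> nonsym_psd k"
  unfolding nonsym_psd_iff
proof (intro conjI allI ballI)
  note A' = nonsym_psd_carrier[OF A]
  show "P\<^sup>T * A * P \<in> carrier_mat k k" using A' P by simp
  fix l and G :: "real mat" assume G: "G \<in> carrier_mat k l"
  have "frob_inner G ((P\<^sup>T * A * P) * G) = frob_inner (P * G) (A * (P * G))"
    using A' P G by (simp add: mult_assoc_dim frob_inner_mult_left)
  also have "0 \<le> \<dots>" using nonsym_psdD[OF A, of "P * G" l] P G by simp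
  finally show "0 \<le> frob_inner G ((P\<^sup>T * A * P) * G)" .
qed

text \<open>The quadratic form ignores the skew part. Feasibility can thus be read off from a Gram
  factorization of the symmetric part.\<close>

lemma nonsym_psd_sym_part_iff:
  assumes A: "A \<in> carrier_mat n n"
  shows "sym_part A \<in> nonsym_psd n \<longleftrightarrow> A \<in> nonsym_psd n"
proof -
  have "frob_inner G (sym_part A * G) = frob_inner G (A * G)" if "G \<in> carrier_mat n k" for G k
    using frob_inner_sym_part[OF A that] A that
    by (simp add: sym_part_def smult_mult_dim frob_inner_smult_right)
  then show ?thesis using A by (simp add: nonsym_psd_iff sym_part_def)
qed

subsection \<open>Positive diagonal matrices\<close>

lemma diagonal_mat_eq_mat_diag:
  "S \<in> carrier_mat r r \<Longrightarrow> diagonal_mat S \<Longrightarrow> S = mat_diag r (\<lambda>i. S $$ (i, i))"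
  by (rule eq_matI) (auto simp: mat_diag_def diagonal_mat_def)

lemma mat_diag_cong: "(\<And>i. i < n \<Longrightarrow> f i = g i) \<Longrightarrow> mat_diag n f = mat_diag n g"
  unfolding mat_diag_def by (rule eq_matI) auto

text \<open>\<open>F\<close> holds the square roots of the diagonal and \<open>E\<close> their
  reciprocals. A symmetric root of the inverse makes \<open>Y * mat_inv S * Y\<^sup>T\<close> a Gram
  matrix.\<close>

lemma positive_diagonal_roots:
  assumes S: "S \<in> carrier_mat r r" and diag: "diagonal_mat S" and pos: "\<forall>i<r. 0 < S $$ (i, i)"
  obtains F E where "F \<in> carrier_mat r r" "E \<in> carrier_mat r r" "F\<^sup>T = F" "E\<^sup>T = E"
    "S = F * F" "E * F = 1\<^sub>m r" "F * E = 1\<^sub>m r" "mat_inv S = E * E"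
proof -
  define F where "F = mat_diag r (\<lambda>i. sqrt (S $$ (i, i)))"
  define E where "E = mat_diag r (\<lambda>i. inverse (sqrt (S $$ (i, i))))"
  have FE: "F \<in> carrier_mat r r" "E \<in> carrier_mat r r" unfolding F_def E_def by simp_all
  have tr: "F\<^sup>T = F" "E\<^sup>T = E" unfolding F_def E_def mat_diag_def by (auto intro!: eq_matI)
  have "mat_diag r (\<lambda>i. S $$ (i, i)) = F * F"
    unfolding F_def mat_diag_diag using pos
    by (intro mat_diag_cong) (simp add: less_imp_le)
  then have S_eq: "S = F * F" using diagonal_mat_eq_mat_diag[OF S diag] by simp
  have nz: "sqrt (S $$ (i, i)) \<noteq> 0" if "i < r" for i using pos that by fastforce
  have "E * F = mat_diag r (\<lambda>i. 1)"
    unfolding E_def F_def mat_diag_diag by (rule mat_diag_cong) (rule left_inverse[OF nz])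
  moreover have "F * E = mat_diag r (\<lambda>i. 1)"
    unfolding E_def F_def mat_diag_diag by (rule mat_diag_cong) (rule right_inverse[OF nz])
  ultimately have inv: "E * F = 1\<^sub>m r" "F * E = 1\<^sub>m r" by simp_all
  have "S * (E * E) = 1\<^sub>m r" "(E * E) * S = 1\<^sub>m r"
    using FE inv unfolding S_eq
    by (simp_all add: mult_assoc_dim mult_assoc_rewrite[OF inv(1)] mult_assoc_rewrite[OF inv(2)] one_mult_dim)
  then have "mat_inv S = E * E" using S FE by (intro mat_inv_eqI[of _ r]) auto
  with FE tr S_eq inv that show thesis by blast
qed

section \<open>Gram matrices and the parallelogram identity\<close>

lemma gram_nonsym_psd:
  assumes C: "C \<in> carrier_mat n k"
  shows "C * C\<^sup>T \<in> nonsym_psd n"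
  unfolding nonsym_psd_iff
proof (intro conjI allI ballI)
  show "C * C\<^sup>T \<in> carrier_mat n n" using C by simp
  fix l and G :: "real mat" assume G: "G \<in> carrier_mat n l"
  have "frob_inner G (C * C\<^sup>T * G) = frob_inner (C\<^sup>T * G) (C\<^sup>T * G)"
    using C G by (simp add: mult_assoc_dim frob_inner_mult_left)
  then show "0 \<le> frob_inner G (C * C\<^sup>T * G)" by (simp add: frob_inner_self_nonneg)
qed

text \<open>Moving \<open>C\<^sup>T\<close> across turns the pairing into the quadratic form of
  \<open>P\<close> at the test matrix \<open>C\<close>. This gives the sign of the mixed term
  whenever the norm of a sum of two cone elements is expanded.\<close>

lemma frob_inner_gram_nonneg:
  assumes C: "C \<in> carrier_mat n k" and P: "P \<in> nonsym_psd n"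
  shows "0 \<le> frob_inner (C * C\<^sup>T) P"
proof -
  note P' = nonsym_psd_carrier[OF P]
  have "frob_inner (C * C\<^sup>T) P = frob_inner C (P * C)"
    using C P' by (simp add: frob_inner_mult_right)
  then show ?thesis using nonsym_psdD[OF P C] by simp
qed

lemma frob_inner_parallelogram:
  assumes "A \<in> carrier_mat p q" "B \<in> carrier_mat p q"
  shows "frob_inner ((1/2) \<cdot>\<^sub>m (A + B)) ((1/2) \<cdot>\<^sub>m (A + B))
    = (frob_inner A A + frob_inner B B) / 2 - frob_inner (A - B) (A - B) / 4"
  using assms frob_inner_commute[of A B]
  by (simp add: frob_inner_simps field_simps)

subsection \<open>Existence and uniqueness of minimizers\<close>

text \<open>Entrywise convergence; the sizes are arguments because matrices of all sizes share one
  type.\<close>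

definition mat_limit :: "nat \<Rightarrow> nat \<Rightarrow> (nat \<Rightarrow> real mat) \<Rightarrow> real mat \<Rightarrow> bool" where
  "mat_limit p q A L \<longleftrightarrow> (\<forall>k. A k \<in> carrier_mat p q) \<and> L \<in> carrier_mat p q
    \<and> (\<forall>i<p. \<forall>j<q. (\<lambda>k. A k $$ (i, j)) \<longlonglongrightarrow> L $$ (i, j))"

lemma mat_limit_const: "A \<in> carrier_mat p q \<Longrightarrow> mat_limit p q (\<lambda>k. A) A"
  by (simp add: mat_limit_def)

lemma mat_limit_transpose:
  assumes "mat_limit p q A L"
  shows "mat_limit q p (\<lambda>k. (A k)\<^sup>T) (L\<^sup>T)"
  unfolding mat_limit_def
proof (intro conjI allI impI)
  have A: "A k \<in> carrier_mat p q" for k using assms by (simp add: mat_limit_def)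
  have L: "L \<in> carrier_mat p q" using assms by (simp add: mat_limit_def)
  show "(A k)\<^sup>T \<in> carrier_mat q p" for k using A[of k] by simp
  show "L\<^sup>T \<in> carrier_mat q p" using L by simp
  fix i j assume ij: "i < q" "j < p"
  have "(A k)\<^sup>T $$ (i, j) = A k $$ (j, i)" for k using A[of k] ij by simp
  moreover have "L\<^sup>T $$ (i, j) = L $$ (j, i)" using L ij by simp
  ultimately show "(\<lambda>k. (A k)\<^sup>T $$ (i, j)) \<longlonglongrightarrow> L\<^sup>T $$ (i, j)"
    using assms ij by (simp add: mat_limit_def)
qed

lemma mat_limit_diff:
  assumes "mat_limit p q A L" "mat_limit p q B M"
  shows "mat_limit p q (\<lambda>k. A k - B k) (L - M)"
  unfolding mat_limit_def
proof (intro conjI allI impI)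
  have A: "A k \<in> carrier_mat p q" and B: "B k \<in> carrier_mat p q" for k
    using assms by (simp_all add: mat_limit_def)
  have L: "L \<in> carrier_mat p q" and M: "M \<in> carrier_mat p q" using assms by (simp_all add: mat_limit_def)
  show "A k - B k \<in> carrier_mat p q" for k by (rule minus_carrier_mat[OF B])
  show "L - M \<in> carrier_mat p q" by (rule minus_carrier_mat[OF M])
  fix i j assume ij: "i < p" "j < q"
  have "(A k - B k) $$ (i, j) = A k $$ (i, j) - B k $$ (i, j)" for k using B[of k] ij by simp
  moreover have "(L - M) $$ (i, j) = L $$ (i, j) - M $$ (i, j)" using M ij by simp
  ultimately show "(\<lambda>k. (A k - B k) $$ (i, j)) \<longlonglongrightarrow> (L - M) $$ (i, j)"
    using assms ij by (simp add: mat_limit_def tendsto_diff)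
qed

lemma mat_limit_mult:
  assumes "mat_limit p q A L" "mat_limit q r B M"
  shows "mat_limit p r (\<lambda>k. A k * B k) (L * M)"
  unfolding mat_limit_def
proof (intro conjI allI impI)
  have A: "A k \<in> carrier_mat p q" and B: "B k \<in> carrier_mat q r" for k
    using assms by (simp_all add: mat_limit_def)
  have L: "L \<in> carrier_mat p q" and M: "M \<in> carrier_mat q r" using assms by (simp_all add: mat_limit_def)
  show "A k * B k \<in> carrier_mat p r" for k by (rule mult_carrier_mat[OF A B])
  show "L * M \<in> carrier_mat p r" by (rule mult_carrier_mat[OF L M])
  fix i j assume ij: "i < p" "j < r"
  have "(A k * B k) $$ (i, j) = (\<Sum>l<q. A k $$ (i, l) * B k $$ (l, j))" for k
    using A[of k] B[of k] ij by (simp add: scalar_prod_def atLeast0LessThan)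
  moreover have "(L * M) $$ (i, j) = (\<Sum>l<q. L $$ (i, l) * M $$ (l, j))"
    using L M ij by (simp add: scalar_prod_def atLeast0LessThan)
  moreover have "(\<lambda>k. \<Sum>l<q. A k $$ (i, l) * B k $$ (l, j)) \<longlonglongrightarrow> (\<Sum>l<q. L $$ (i, l) * M $$ (l, j))"
    using assms ij by (intro tendsto_sum tendsto_mult) (auto simp: mat_limit_def)
  ultimately show "(\<lambda>k. (A k * B k) $$ (i, j)) \<longlonglongrightarrow> (L * M) $$ (i, j)" by simp
qed

lemma frob_inner_self_tendsto:
  assumes "mat_limit p q A L"
  shows "(\<lambda>k. frob_inner (A k) (A k)) \<longlonglongrightarrow> frob_inner L L"
proof -
  have A: "dim_row (A k) = p" "dim_col (A k) = q" for k using assms by (auto simp: mat_limit_def)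
  have L: "dim_row L = p" "dim_col L = q" using assms by (auto simp: mat_limit_def)
  show ?thesis unfolding frob_inner_def A L
    using assms by (intro tendsto_sum tendsto_mult) (auto simp: mat_limit_def)
qed

lemma entry_sq_le_frob_inner:
  assumes "i < dim_row A" "j < dim_col A"
  shows "(A $$ (i, j))\<^sup>2 \<le> frob_inner A A"
proof -
  have "(A $$ (i, j))\<^sup>2 \<le> (\<Sum>j<dim_col A. A $$ (i, j) * A $$ (i, j))"
    using member_le_sum[of j "{..<dim_col A}" "\<lambda>j. A $$ (i, j) * A $$ (i, j)"] assms
    by (simp add: power2_eq_square)
  also have "\<dots> \<le> frob_inner A A"
    unfolding frob_inner_def
    using member_le_sum[of i "{..<dim_row A}" "\<lambda>i. \<Sum>j<dim_col A. A $$ (i, j) * A $$ (i, j)"] assms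
    by (simp add: sum_nonneg)
  finally show ?thesis .
qed

text \<open>Comparing the infimum with the value at a midpoint bounds the distance of two points by
  their excesses over the infimum. One bound thus yields both the Cauchy property of a minimizing
  sequence and uniqueness, without a compactness argument.\<close>

lemma strongly_midconvex_unique_minimizer:
  fixes f :: "real mat \<Rightarrow> real"
  assumes nonneg: "\<And>Y. Y \<in> carrier_mat p q \<Longrightarrow> 0 \<le> f Y"
    and mid: "\<And>Y Y'. Y \<in> carrier_mat p q \<Longrightarrow> Y' \<in> carrier_mat p q \<Longrightarrow>
      f ((1/2) \<cdot>\<^sub>m (Y + Y')) \<le> (f Y + f Y') / 2 - frob_inner (Y - Y') (Y - Y') / 4"
    and cont: "\<And>Y L. mat_limit p q Y L \<Longrightarrow> (\<lambda>k. f (Y k)) \<longlonglongrightarrow> f L"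
  obtains L where "L \<in> carrier_mat p q" "\<And>Y. Y \<in> carrier_mat p q \<Longrightarrow> f L \<le> f Y"
    "\<And>Y. Y \<in> carrier_mat p q \<Longrightarrow> f Y \<le> f L \<Longrightarrow> Y = L"
proof -
  define m where "m = (INF Y \<in> carrier_mat p q. f Y)"
  have ne: "f ` carrier_mat p q \<noteq> {}" using zero_carrier_mat by blast
  have bdd: "bdd_below (f ` carrier_mat p q)" using nonneg by (auto intro!: bdd_belowI[of _ 0])
  have m_le: "m \<le> f Y" if "Y \<in> carrier_mat p q" for Y
    unfolding m_def using that bdd by (auto intro: cInf_lower)
  \<comment> \<open>Rearranged from \<open>mid\<close>, using that the midpoint has value at least
    \<open>m\<close>.\<close>
  have gap: "frob_inner (Y - Y') (Y - Y') \<le> 2 * (f Y - m) + 2 * (f Y' - m)"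
    if "Y \<in> carrier_mat p q" "Y' \<in> carrier_mat p q" for Y Y'
  proof -
    have "m \<le> f ((1/2) \<cdot>\<^sub>m (Y + Y'))" using that by (intro m_le) simp
    with mid[OF that] show ?thesis by argo
  qed
  have "\<exists>Y \<in> carrier_mat p q. f Y < m + inverse (real (Suc k))" for k
  proof -
    have "Inf (f ` carrier_mat p q) < m + inverse (real (Suc k))" unfolding m_def by simp
    from cInf_lessD[OF ne this] show ?thesis by blast
  qed
  then obtain Y where Y: "\<And>k. Y k \<in> carrier_mat p q" and fY: "\<And>k. f (Y k) < m + inverse (real (Suc k))"
    by metis
  have inv0: "(\<lambda>k. inverse (real (Suc k))) \<longlonglongrightarrow> 0" by (rule LIMSEQ_inverse_real_of_nat)
  have conv: "convergent (\<lambda>k. Y k $$ (i, j))" if ij: "i < p" "j < q" for i j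
  proof -
    have "Cauchy (\<lambda>k. Y k $$ (i, j))"
    proof (rule CauchyI)
      fix e :: real assume e: "0 < e"
      \<comment> \<open>With excess below e^2/4 each of the two terms in \<open>gap\<close> is below
        e^2/2.\<close>
      then have "eventually (\<lambda>k. inverse (real (Suc k)) < e\<^sup>2 / 4) sequentially"
        using order_tendstoD(2)[OF inv0, of "e\<^sup>2 / 4"] by simp
      then obtain K where K: "\<And>k. K \<le> k \<Longrightarrow> inverse (real (Suc k)) < e\<^sup>2 / 4"
        by (auto simp: eventually_sequentially)
      have "norm (Y k $$ (i, j) - Y l $$ (i, j)) < e" if "K \<le> k" "K \<le> l" for k l
      proof -
        have "(Y k $$ (i, j) - Y l $$ (i, j))\<^sup>2 \<le> frob_inner (Y k - Y l) (Y k - Y l)"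
          using entry_sq_le_frob_inner[of i "Y k - Y l" j] Y[of k] Y[of l] ij by simp
        also have "\<dots> \<le> 2 * (f (Y k) - m) + 2 * (f (Y l) - m)" by (rule gap[OF Y Y])
        also have "\<dots> < e\<^sup>2" using fY[of k] fY[of l] K[OF that(1)] K[OF that(2)] by argo
        finally show ?thesis using e power_less_imp_less_base[of "\<bar>Y k $$ (i, j) - Y l $$ (i, j)\<bar>" 2 e] by simp
      qed
      then show "\<exists>M. \<forall>k\<ge>M. \<forall>l\<ge>M. norm (Y k $$ (i, j) - Y l $$ (i, j)) < e" by blast
    qed
    then show ?thesis by (simp add: Cauchy_convergent_iff)
  qed
  define L where "L = mat p q (\<lambda>(i, j). lim (\<lambda>k. Y k $$ (i, j)))"
  have L: "L \<in> carrier_mat p q" unfolding L_def by simp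
  have "mat_limit p q Y L"
    unfolding mat_limit_def using Y L conv by (auto simp: L_def convergent_LIMSEQ_iff)
  then have lim: "(\<lambda>k. f (Y k)) \<longlonglongrightarrow> f L" by (rule cont)
  moreover have "(\<lambda>k. m + inverse (real (Suc k))) \<longlonglongrightarrow> m"
    using tendsto_add[OF tendsto_const inv0, of m] by simp
  ultimately have "f L \<le> m" using fY by (intro LIMSEQ_le[OF lim]) (auto intro: less_imp_le)
  then have min: "f L \<le> f Y'" if "Y' \<in> carrier_mat p q" for Y' using m_le[OF that] by simp
  have "Y' = L" if Y': "Y' \<in> carrier_mat p q" and "f Y' \<le> f L" for Y'
  proof -
    \<comment> \<open>Both excesses over \<open>m\<close> are nonpositive here, so
      \<open>gap\<close> leaves no distance.\<close>
    have "frob_inner (Y' - L) (Y' - L) \<le> 0" using gap[OF Y' L] \<open>f L \<le> m\<close> that(2) by argo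
    then have "frob_inner (Y' - L) (Y' - L) = 0" using frob_inner_self_nonneg by (intro antisym)
    then have "Y' - L = 0\<^sub>m p q" using frob_inner_self_eq_0[of "Y' - L"] L by simp
    then have "(Y' - L) $$ (i, j) = 0" if "i < p" "j < q" for i j using that by simp
    then show "Y' = L" using Y' L by (intro eq_matI) auto
  qed
  with L min that show thesis by blast
qed

text \<open>The linear residual alone supplies the strong convexity: its parallelogram term is the
  squared distance of the two points, since \<open>W\<close> has orthonormal columns. The quartic
  term then has only to be midpoint convex.\<close>

lemma quartic_objective_unique_minimizer:
  fixes W Z E :: "real mat"
  assumes W: "W \<in> carrier_mat r s" and WW: "W\<^sup>T * W = 1\<^sub>m s" and Z: "Z \<in> carrier_mat p r"
    and E: "E \<in> carrier_mat s s" "E\<^sup>T = E"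
  defines "f \<equiv> \<lambda>Y. frob_inner (Y * W\<^sup>T - Z) (Y * W\<^sup>T - Z)
    + 1/16 * frob_inner (Y * (E * E) * Y\<^sup>T) (Y * (E * E) * Y\<^sup>T)"
  obtains L where "L \<in> carrier_mat p s" "\<And>Y. Y \<in> carrier_mat p s \<Longrightarrow> f L \<le> f Y"
    "\<And>Y. Y \<in> carrier_mat p s \<Longrightarrow> f Y \<le> f L \<Longrightarrow> Y = L"
proof (rule strongly_midconvex_unique_minimizer[of p s f])
  show "0 \<le> f Y" for Y unfolding f_def by (simp add: frob_inner_self_nonneg)
next
  fix Y Y' :: "real mat" assume Y: "Y \<in> carrier_mat p s" and Y': "Y' \<in> carrier_mat p s"
  note d = W Z E Y Y'
  define M where "M = (1/2) \<cdot>\<^sub>m (Y + Y')"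
  define N where "N = (1/2) \<cdot>\<^sub>m (Y - Y')"
  have MN: "M \<in> carrier_mat p s" "N \<in> carrier_mat p s" unfolding M_def N_def using Y Y' by (simp_all add: minus_carrier_mat)
  have "M * W\<^sup>T - Z = (1/2) \<cdot>\<^sub>m ((Y * W\<^sup>T - Z) + (Y' * W\<^sup>T - Z))"
    unfolding M_def using d
    by (intro eq_matI) (simp_all add: smult_mult_dim add_mult_dim field_simps del: index_mult_mat(1))
  moreover have "(Y * W\<^sup>T - Z) - (Y' * W\<^sup>T - Z) = (Y - Y') * W\<^sup>T"
    using d by (intro eq_matI) (simp_all add: minus_mult_dim del: index_mult_mat(1))
  moreover have "frob_inner ((Y - Y') * W\<^sup>T) ((Y - Y') * W\<^sup>T) = frob_inner (Y - Y') (Y - Y')"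
    using d by (simp add: frob_inner_mult_right mult_assoc_dim WW mult_one_dim)
  ultimately have lin: "frob_inner (M * W\<^sup>T - Z) (M * W\<^sup>T - Z)
      = (frob_inner (Y * W\<^sup>T - Z) (Y * W\<^sup>T - Z) + frob_inner (Y' * W\<^sup>T - Z) (Y' * W\<^sup>T - Z)) / 2
        - frob_inner (Y - Y') (Y - Y') / 4"
    using frob_inner_parallelogram[of "Y * W\<^sup>T - Z" p r "Y' * W\<^sup>T - Z"] d by (simp add: minus_carrier_mat)
  define g where "g = (\<lambda>Y. Y * (E * E) * Y\<^sup>T)"
  have gram: "g A = (A * E) * (A * E)\<^sup>T" if "A \<in> carrier_mat p s" for A
    unfolding g_def using that E by (simp add: mult_assoc_dim transpose_mult_dim)
  have g_carrier: "g A \<in> carrier_mat p p" if "A \<in> carrier_mat p s" for A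
    unfolding g_def using that E by (intro carrier_matI) simp_all
  \<comment> \<open>From \<open>Y = M + N\<close> and \<open>Y' = M - N\<close> the mixed terms
    cancel, so the average of \<open>g Y\<close> and \<open>g Y'\<close> exceeds \<open>g M\<close>
    by the Gram matrix \<open>g N\<close>.\<close>
  have Q: "(1/2) \<cdot>\<^sub>m (g Y + g Y') = g M + g N"
    unfolding g_def M_def N_def using d
    by (intro eq_matI)
      (simp_all add: mat_dim_simps add_mult_dim minus_mult_dim field_simps del: index_mult_mat(1))
  note gc = g_carrier[OF MN(1)] g_carrier[OF MN(2)] g_carrier[OF Y] g_carrier[OF Y']
  \<comment> \<open>Gram matrices pair nonnegatively, so dropping \<open>g N\<close> cannot raise
    the norm.\<close>
  have "0 \<le> frob_inner (g M) (g N)"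
    using frob_inner_gram_nonneg[of "M * E" p s "g N"] gram_nonsym_psd[of "N * E" p s] gram MN E by simp
  then have "frob_inner (g M) (g M) \<le> frob_inner (g M + g N) (g M + g N)"
    using gc frob_inner_self_nonneg[of "g N"] frob_inner_commute[of "g M" "g N"]
    by (simp add: frob_inner_simps)
  also have "\<dots> \<le> (frob_inner (g Y) (g Y) + frob_inner (g Y') (g Y')) / 2"
    unfolding Q[symmetric] frob_inner_parallelogram[OF gc(3,4)]
    using frob_inner_self_nonneg[of "g Y - g Y'"] by argo
  finally show "f ((1/2) \<cdot>\<^sub>m (Y + Y')) \<le> (f Y + f Y') / 2 - frob_inner (Y - Y') (Y - Y') / 4"
    unfolding M_def[symmetric] f_def g_def lin by argo
next
  fix Y L assume lim: "mat_limit p s Y L"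
  show "(\<lambda>k. f (Y k)) \<longlonglongrightarrow> f L"
    unfolding f_def
    by (intro tendsto_add tendsto_mult tendsto_const frob_inner_self_tendsto[of p r]
        frob_inner_self_tendsto[of p p] mat_limit_diff
        mat_limit_mult[of p s _ _ r] mat_limit_mult[of p s _ _ p] mat_limit_mult[of p s _ _ s]
        mat_limit_transpose[of p s] lim mat_limit_const transpose_carrier_mat[THEN iffD2] Z W)
      (use W E in auto)
qed (rule that)

subsection \<open>Orthonormal frames\<close>

lemma hcat_carrier:
  "P \<in> carrier_mat n r \<Longrightarrow> Q \<in> carrier_mat n k \<Longrightarrow> hcat P Q \<in> carrier_mat n (r + k)"
  unfolding hcat_def using four_block_carrier_mat[of P n r "0\<^sub>m 0 (dim_col Q)" 0 k] by simp

lemma four_block_mat_inject: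
  assumes "four_block_mat A B C D = four_block_mat A' B' C' D'"
    and "A \<in> carrier_mat p q" "B \<in> carrier_mat p l" "C \<in> carrier_mat k q" "D \<in> carrier_mat k l"
    and "A' \<in> carrier_mat p q" "B' \<in> carrier_mat p l" "C' \<in> carrier_mat k q" "D' \<in> carrier_mat k l"
  shows "A = A'" "B = B'" "C = C'" "D = D'"
proof -
  have e: "four_block_mat A B C D $$ (i, j) = four_block_mat A' B' C' D' $$ (i, j)" for i j
    using assms(1) by simp
  show "A = A'"
  proof (rule eq_matI)
    show "A $$ (i, j) = A' $$ (i, j)" if "i < dim_row A'" "j < dim_col A'" for i j
      using e[of i j] assms(2-9) that by simp
  qed (use assms(2-9) in auto)
  show "B = B'"
  proof (rule eq_matI)
    show "B $$ (i, j) = B' $$ (i, j)" if "i < dim_row B'" "j < dim_col B'" for i j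
      using e[of i "q + j"] assms(2-9) that by simp
  qed (use assms(2-9) in auto)
  show "C = C'"
  proof (rule eq_matI)
    show "C $$ (i, j) = C' $$ (i, j)" if "i < dim_row C'" "j < dim_col C'" for i j
      using e[of "p + i" j] assms(2-9) that by simp
  qed (use assms(2-9) in auto)
  show "D = D'"
  proof (rule eq_matI)
    show "D $$ (i, j) = D' $$ (i, j)" if "i < dim_row D'" "j < dim_col D'" for i j
      using e[of "p + i" "q + j"] assms(2-9) that by simp
  qed (use assms(2-9) in auto)
qed

text \<open>Block multiplication yields a sum of ordinary products, so later arguments can avoid
  block matrices. Different frames on the two sides cover both the decomposition of \<open>X\<close>
  and conjugation by \<open>U\<close>.\<close>

lemma hcat_block_transpose:
  assumes P: "P \<in> carrier_mat n r" and Q: "Q \<in> carrier_mat n k"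
    and P': "P' \<in> carrier_mat m l" and Q': "Q' \<in> carrier_mat m h"
    and A: "A \<in> carrier_mat r l" and B: "B \<in> carrier_mat r h"
    and C: "C \<in> carrier_mat k l" and D: "D \<in> carrier_mat k h"
  shows "hcat P Q * four_block_mat A B C D * (hcat P' Q')\<^sup>T
    = (P * A + Q * C) * P'\<^sup>T + (P * B + Q * D) * Q'\<^sup>T"
proof -
  have "hcat P Q * four_block_mat A B C D
    = four_block_mat (P * A + Q * C) (P * B + Q * D) (0\<^sub>m 0 l) (0\<^sub>m 0 h)"
    unfolding hcat_def using P Q A B C D
    by (subst mult_four_block_mat[of _ n r _ k _ 0 _ _ l _ h]) (auto intro!: cong_four_block_mat)
  moreover have "(hcat P' Q')\<^sup>T = four_block_mat (P'\<^sup>T) (0\<^sub>m l 0) (Q'\<^sup>T) (0\<^sub>m h 0)"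
    unfolding hcat_def using P' Q'
    by (subst transpose_four_block_mat[of _ m l _ h _ 0]) auto
  ultimately have "hcat P Q * four_block_mat A B C D * (hcat P' Q')\<^sup>T
    = four_block_mat ((P * A + Q * C) * P'\<^sup>T + (P * B + Q * D) * Q'\<^sup>T) (0\<^sub>m n 0) (0\<^sub>m 0 m) (0\<^sub>m 0 0)"
    using P Q P' Q' A B C D
    by (simp, subst mult_four_block_mat[of _ n l _ h _ 0 _ _ m _ 0]) (auto intro!: cong_four_block_mat)
  \<comment> \<open>The other three blocks are empty.\<close>
  also have "\<dots> = (P * A + Q * C) * P'\<^sup>T + (P * B + Q * D) * Q'\<^sup>T"
    using P Q P' Q' A B C D by (intro eq_matI) (auto simp del: index_mult_mat(1))
  finally show ?thesis .
qed

lemma orthonormal_hcatD: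
  assumes o: "orthonormal_mat n (hcat P Q)" and P: "P \<in> carrier_mat n r" and Q: "Q \<in> carrier_mat n (n - r)"
  shows "P\<^sup>T * P = 1\<^sub>m r" "P\<^sup>T * Q = 0\<^sub>m r (n - r)" "Q\<^sup>T * P = 0\<^sub>m (n - r) r"
    "Q\<^sup>T * Q = 1\<^sub>m (n - r)" "P * P\<^sup>T + Q * Q\<^sup>T = 1\<^sub>m n"
proof -
  \<comment> \<open>Subtraction is truncated; that \<open>r\<close> does not exceed \<open>n\<close>
    follows because an orthonormal matrix has exactly \<open>n\<close> columns.\<close>
  have n: "n = r + (n - r)"
    using o hcat_carrier[OF P Q] unfolding orthonormal_mat_def by auto
  have "(hcat P Q)\<^sup>T * hcat P Q = four_block_mat (P\<^sup>T) (0\<^sub>m r 0) (Q\<^sup>T) (0\<^sub>m (n - r) 0)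
      * four_block_mat P Q (0\<^sub>m 0 r) (0\<^sub>m 0 (n - r))"
    unfolding hcat_def using P Q
    by (subst transpose_four_block_mat[of _ n r _ "n - r" _ 0]) auto
  also have "\<dots> = four_block_mat (P\<^sup>T * P) (P\<^sup>T * Q) (Q\<^sup>T * P) (Q\<^sup>T * Q)"
    using P Q by (subst mult_four_block_mat[of _ r n _ 0 _ "n - r" _ _ r _ "n - r"])
      (auto intro!: cong_four_block_mat simp: add_zero_dim)
  finally have "four_block_mat (P\<^sup>T * P) (P\<^sup>T * Q) (Q\<^sup>T * P) (Q\<^sup>T * Q)
    = four_block_mat (1\<^sub>m r) (0\<^sub>m r (n - r)) (0\<^sub>m (n - r) r) (1\<^sub>m (n - r))"
    using o n unfolding orthonormal_mat_def by simp
  from four_block_mat_inject[OF this, of r r "n - r" "n - r"]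
  show "P\<^sup>T * P = 1\<^sub>m r" "P\<^sup>T * Q = 0\<^sub>m r (n - r)" "Q\<^sup>T * P = 0\<^sub>m (n - r) r" "Q\<^sup>T * Q = 1\<^sub>m (n - r)"
    using P Q by auto
  have "hcat P Q * (hcat P Q)\<^sup>T
    = hcat P Q * four_block_mat (1\<^sub>m r) (0\<^sub>m r (n - r)) (0\<^sub>m (n - r) r) (1\<^sub>m (n - r)) * (hcat P Q)\<^sup>T"
    using hcat_carrier[OF P Q] n by (simp add: mult_one_dim)
  also have "\<dots> = P * P\<^sup>T + Q * Q\<^sup>T"
    using P Q by (subst hcat_block_transpose[of _ n r _ "n - r" _ n r _ "n - r"])
      (auto simp: mult_one_dim mult_zero_dim add_zero_dim zero_add_dim)
  finally show "P * P\<^sup>T + Q * Q\<^sup>T = 1\<^sub>m n" using o unfolding orthonormal_mat_def by simp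
qed

text \<open>Strict convexity; injectivity of \<open>\<lambda>A. A * S\<close> comes from the right inverse \<open>T\<close> of \<open>S\<close>.\<close>

lemma procrustes_solution_unique:
  assumes S: "S \<in> carrier_mat r r" and T: "T \<in> carrier_mat r r" "S * T = 1\<^sub>m r"
    and B: "B \<in> carrier_mat r r"
    and A: "procrustes_solution r S B A" and A': "A' \<in> nonsym_psd r"
    and le: "frob_inner (A' * S - B) (A' * S - B) \<le> frob_inner (A * S - B) (A * S - B)"
  shows "A' = A"
proof -
  let ?M = "(1/2) \<cdot>\<^sub>m (A + A')"
  have A_psd: "A \<in> nonsym_psd r"
    and A_min: "\<And>C. C \<in> nonsym_psd r \<Longrightarrow>
      frob_inner (A * S - B) (A * S - B) \<le> frob_inner (C * S - B) (C * S - B)"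
    using A unfolding procrustes_solution_def is_arg_min_linorder fro_norm_sq by auto
  note c = nonsym_psd_carrier[OF A_psd] nonsym_psd_carrier[OF A'] S B
  have "0 \<le> frob_inner G (?M * G)" if "G \<in> carrier_mat r k" for G k
    using nonsym_psdD[OF A_psd that] nonsym_psdD[OF A' that] that c
    by (simp add: smult_mult_dim add_mult_dim frob_inner_simps)
  then have "?M \<in> nonsym_psd r" using c by (simp add: nonsym_psd_iff)
  \<comment> \<open>Minimality of \<open>A\<close> against the midpoint, combined with
    \<open>le\<close>, leaves no room for the subtracted parallelogram term, so the residuals
    agree.\<close>
  then have "frob_inner (A * S - B) (A * S - B) \<le> frob_inner (?M * S - B) (?M * S - B)" by (rule A_min)
  also have "?M * S - B = (1/2) \<cdot>\<^sub>m ((A * S - B) + (A' * S - B))"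
    using c by (intro eq_matI) (simp_all add: smult_mult_dim add_mult_dim field_simps del: index_mult_mat(1))
  also have "frob_inner \<dots> \<dots> = (frob_inner (A * S - B) (A * S - B) + frob_inner (A' * S - B) (A' * S - B)) / 2
    - frob_inner ((A * S - B) - (A' * S - B)) ((A * S - B) - (A' * S - B)) / 4"
    using c by (intro frob_inner_parallelogram[of _ r r]) (simp_all add: minus_carrier_mat)
  finally have "frob_inner ((A * S - B) - (A' * S - B)) ((A * S - B) - (A' * S - B)) \<le> 0"
    using le by argo
  then have "frob_inner ((A * S - B) - (A' * S - B)) ((A * S - B) - (A' * S - B)) = 0"
    using frob_inner_self_nonneg by (intro antisym)
  then have z: "(A * S - B) - (A' * S - B) = 0\<^sub>m r r"
    using frob_inner_self_eq_0 c by fastforce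
  have "A * S = A' * S"
  proof (rule eq_matI)
    fix i j assume "i < dim_row (A' * S)" "j < dim_col (A' * S)"
    moreover have "((A * S - B) - (A' * S - B)) $$ (i, j) = 0\<^sub>m r r $$ (i, j)" using z by simp
    ultimately show "(A * S) $$ (i, j) = (A' * S) $$ (i, j)"
      using c by (simp del: index_mult_mat(1))
  qed (use c in auto)
  then have "A * S * T = A' * S * T" by simp
  then show ?thesis using c T by (simp add: mult_assoc_dim mult_one_dim)
qed

text \<open>Pythagoras: insert the resolution of the identity in the second argument, then move
  \<open>P\<close> and \<open>Q\<close> to the first.\<close>

lemma frob_inner_split_rows:
  assumes P: "P \<in> carrier_mat n r" and Q: "Q \<in> carrier_mat n k" and M: "M \<in> carrier_mat n l"
    and complete: "P * P\<^sup>T + Q * Q\<^sup>T = 1\<^sub>m n"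
  shows "frob_inner M M = frob_inner (P\<^sup>T * M) (P\<^sup>T * M) + frob_inner (Q\<^sup>T * M) (Q\<^sup>T * M)"
proof -
  have "M = (P * P\<^sup>T + Q * Q\<^sup>T) * M" unfolding complete using M by (simp add: one_mult_dim)
  also have "\<dots> = P * (P\<^sup>T * M) + Q * (Q\<^sup>T * M)"
    using P Q M by (simp add: add_mult_dim mult_assoc_dim)
  finally have "frob_inner M M = frob_inner M (P * (P\<^sup>T * M) + Q * (Q\<^sup>T * M))"
    by (rule arg_cong)
  also have "\<dots> = frob_inner M (P * (P\<^sup>T * M)) + frob_inner M (Q * (Q\<^sup>T * M))"
    using P Q M by (intro frob_inner_add_right) simp_all
  also have "\<dots> = frob_inner (P\<^sup>T * M) (P\<^sup>T * M) + frob_inner (Q\<^sup>T * M) (Q\<^sup>T * M)"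
    using P Q M by (simp add: frob_inner_mult_left)
  finally show ?thesis .
qed

lemma frob_inner_split_cols:
  assumes "P \<in> carrier_mat n r" "Q \<in> carrier_mat n k" "M \<in> carrier_mat l n"
    and "P * P\<^sup>T + Q * Q\<^sup>T = 1\<^sub>m n"
  shows "frob_inner M M = frob_inner (M * P) (M * P) + frob_inner (M * Q) (M * Q)"
proof -
  have swap: "frob_inner (N\<^sup>T) (N\<^sup>T) = frob_inner N N" for N by (rule frob_inner_transpose) simp_all
  have "P\<^sup>T * M\<^sup>T = (M * P)\<^sup>T" "Q\<^sup>T * M\<^sup>T = (M * Q)\<^sup>T" using assms by (simp_all add: transpose_mult_dim)
  then show ?thesis
    using frob_inner_split_rows[of P n r Q k "M\<^sup>T" l] assms by (simp add: swap)
qed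

lemma minus_eq_zero_mat:
  assumes "A - B = (0\<^sub>m p q :: 'a :: group_add mat)" "A \<in> carrier_mat p q" "B \<in> carrier_mat p q"
  shows "A = B"
proof (rule eq_matI)
  fix i j assume ij: "i < dim_row B" "j < dim_col B"
  have "(A - B) $$ (i, j) = 0\<^sub>m p q $$ (i, j)" using assms(1) by simp
  then show "A $$ (i, j) = B $$ (i, j)" using ij assms(2,3) by simp
qed (use assms in auto)

subsection \<open>The minimizers in the coordinates of the singular value decomposition\<close>

text \<open>\<open>S\<close> is \<open>\<Sigma>\<^sub>1\<close> and \<open>T\<close> its inverse; \<open>F\<close> and \<open>E\<close> are square roots of \<open>\<Lambda>\<close> and of its inverse.\<close>

locale procrustes_frame =
  fixes n m r p q s t :: nat
    and X B U1 U2 S T V1 V2 A11 Z W1 W2 F E :: "real mat"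
  assumes carriers: "X \<in> carrier_mat n m" "B \<in> carrier_mat n m"
      "U1 \<in> carrier_mat n r" "U2 \<in> carrier_mat n p"
      "V1 \<in> carrier_mat m r" "V2 \<in> carrier_mat m q" "S \<in> carrier_mat r r" "T \<in> carrier_mat r r"
      "W1 \<in> carrier_mat r s" "W2 \<in> carrier_mat r t" "F \<in> carrier_mat s s" "E \<in> carrier_mat s s"
    and U: "U1\<^sup>T * U1 = 1\<^sub>m r" "U1\<^sup>T * U2 = 0\<^sub>m r p" "U2\<^sup>T * U1 = 0\<^sub>m p r" "U2\<^sup>T * U2 = 1\<^sub>m p"
    and U_complete: "U1 * U1\<^sup>T + U2 * U2\<^sup>T = 1\<^sub>m n"
    and V: "V1\<^sup>T * V1 = 1\<^sub>m r" "V1\<^sup>T * V2 = 0\<^sub>m r q"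
    and V_complete: "V1 * V1\<^sup>T + V2 * V2\<^sup>T = 1\<^sub>m m"
    and W: "W1\<^sup>T * W1 = 1\<^sub>m s" "W1\<^sup>T * W2 = 0\<^sub>m s t"
    and W_complete: "W1 * W1\<^sup>T + W2 * W2\<^sup>T = 1\<^sub>m r"
    and X_eq: "X = U1 * S * V1\<^sup>T"
    and T: "S * T = 1\<^sub>m r" "T * S = 1\<^sub>m r"
    and EF: "F\<^sup>T = F" "E\<^sup>T = E" "E * F = 1\<^sub>m s" "F * E = 1\<^sub>m s"
    and A11_min: "procrustes_solution r S (U1\<^sup>T * B * V1) A11"
    and sym_A11: "sym_part A11 = W1 * (F * F) * W1\<^sup>T"
    and Z_eq: "Z = U2\<^sup>T * B * V1 * T"
begin

lemma A11_psd: "A11 \<in> nonsym_psd r"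
  using A11_min unfolding procrustes_solution_def is_arg_min_def by blast

lemma A11_carrier: "A11 \<in> carrier_mat r r"
  by (rule nonsym_psd_carrier[OF A11_psd])

lemma Z_carrier: "Z \<in> carrier_mat p r"
  unfolding Z_eq using carriers by (intro carrier_matI) auto

lemma dims [simp]:
  "dim_row X = n" "dim_col X = m" "dim_row B = n" "dim_col B = m" "dim_row U1 = n" "dim_col U1 = r"
  "dim_row U2 = n" "dim_col U2 = p" "dim_row V1 = m" "dim_col V1 = r" "dim_row V2 = m" "dim_col V2 = q"
  "dim_row S = r" "dim_col S = r" "dim_row T = r" "dim_col T = r" "dim_row W1 = r" "dim_col W1 = s"
  "dim_row W2 = r" "dim_col W2 = t" "dim_row F = s" "dim_col F = s" "dim_row E = s" "dim_col E = s"
  "dim_row A11 = r" "dim_col A11 = r" "dim_row Z = p" "dim_col Z = r"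
  using carriers A11_carrier Z_carrier by auto

lemmas U_rewrite = mult_assoc_rewrite[OF U(1)] mult_assoc_rewrite[OF U(2)]
  mult_assoc_rewrite[OF U(3)] mult_assoc_rewrite[OF U(4)]
lemmas W_rewrite = mult_assoc_rewrite[OF W(1)] mult_assoc_rewrite[OF W(2)]
lemmas EF_rewrite = mult_assoc_rewrite[OF EF(3)] mult_assoc_rewrite[OF EF(4)]

text \<open>The block matrix with rows \<open>P Q\<close> and \<open>R D\<close>, conjugated by
  \<open>(U1 U2)\<close> and multiplied out.\<close>

definition from_blocks :: "real mat \<Rightarrow> real mat \<Rightarrow> real mat \<Rightarrow> real mat \<Rightarrow> real mat" where
  "from_blocks P Q R D = U1 * P * U1\<^sup>T + U1 * Q * U2\<^sup>T + U2 * R * U1\<^sup>T + U2 * D * U2\<^sup>T"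

lemma from_blocks_carrier [simp]: "from_blocks P Q R D \<in> carrier_mat n n"
  unfolding from_blocks_def by (intro carrier_matI) simp_all

lemma blocks_from_blocks:
  assumes "P \<in> carrier_mat r r" "Q \<in> carrier_mat r p" "R \<in> carrier_mat p r" "D \<in> carrier_mat p p"
  shows "U1\<^sup>T * from_blocks P Q R D * U1 = P" "U1\<^sup>T * from_blocks P Q R D * U2 = Q"
    "U2\<^sup>T * from_blocks P Q R D * U1 = R" "U2\<^sup>T * from_blocks P Q R D * U2 = D"
  using assms unfolding from_blocks_def
  by (simp_all add: mat_dim_simps U U_rewrite)

lemma from_blocks_blocks:
  assumes "A \<in> carrier_mat n n"
  shows "A = from_blocks (U1\<^sup>T * A * U1) (U1\<^sup>T * A * U2) (U2\<^sup>T * A * U1) (U2\<^sup>T * A * U2)"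
proof -
  have "A = (U1 * U1\<^sup>T + U2 * U2\<^sup>T) * A * (U1 * U1\<^sup>T + U2 * U2\<^sup>T)"
    unfolding U_complete using assms by (simp add: mult_one_dim one_mult_dim)
  also have "\<dots> = from_blocks (U1\<^sup>T * A * U1) (U1\<^sup>T * A * U2) (U2\<^sup>T * A * U1) (U2\<^sup>T * A * U2)"
    unfolding from_blocks_def using assms
    by (intro eq_matI) (simp_all add: mat_dim_simps del: index_mult_mat(1))
  finally show ?thesis .
qed

lemma frob_inner_blocks:
  assumes "A \<in> carrier_mat n n"
  shows "frob_inner A A
    = frob_inner (U1\<^sup>T * A * U1) (U1\<^sup>T * A * U1) + frob_inner (U1\<^sup>T * A * U2) (U1\<^sup>T * A * U2)
      + frob_inner (U2\<^sup>T * A * U1) (U2\<^sup>T * A * U1) + frob_inner (U2\<^sup>T * A * U2) (U2\<^sup>T * A * U2)"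
proof -
  note rows = frob_inner_split_rows[OF carriers(3,4) _ U_complete]
  note cols = frob_inner_split_cols[OF carriers(3,4) _ U_complete]
  have c: "U1\<^sup>T * A \<in> carrier_mat r n" "U2\<^sup>T * A \<in> carrier_mat p n"
    using assms by (auto intro!: carrier_matI)
  show ?thesis using rows[OF assms] cols[OF c(1)] cols[OF c(2)] by linarith
qed

text \<open>Since \<open>X * V1 = U1 * S\<close> and \<open>X * V2 = 0\<close>, splitting along
  \<open>V\<close> isolates the constant \<open>B * V2\<close>; splitting the rest along
  \<open>U\<close> separates the two blocks of \<open>A\<close> that the residual sees. The right
  blocks of \<open>A\<close> stay free.\<close>

lemma residual_split:
  assumes A: "A \<in> carrier_mat n n"
  shows "frob_inner (A * X - B) (A * X - B)
    = frob_inner (U1\<^sup>T * A * U1 * S - U1\<^sup>T * B * V1) (U1\<^sup>T * A * U1 * S - U1\<^sup>T * B * V1)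
      + frob_inner (U2\<^sup>T * A * U1 * S - U2\<^sup>T * B * V1) (U2\<^sup>T * A * U1 * S - U2\<^sup>T * B * V1)
      + frob_inner (B * V2) (B * V2)"
proof -
  have "A * X - B \<in> carrier_mat n m" using A by (intro carrier_matI) simp_all
  note split = frob_inner_split_cols[OF carriers(5,6) this V_complete]
  have 1: "(A * X - B) * V1 = A * U1 * S - B * V1"
    unfolding X_eq using A by (simp add: mat_dim_simps V)
  have 2: "(A * X - B) * V2 = 0\<^sub>m n q - B * V2"
    unfolding X_eq using A by (simp add: mat_dim_simps V)
  have "A * U1 * S - B * V1 \<in> carrier_mat n r" using A by (intro carrier_matI) simp_all
  note rows = frob_inner_split_rows[OF carriers(3,4) this U_complete]
  have 3: "U1\<^sup>T * (A * U1 * S - B * V1) = U1\<^sup>T * A * U1 * S - U1\<^sup>T * B * V1"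
    "U2\<^sup>T * (A * U1 * S - B * V1) = U2\<^sup>T * A * U1 * S - U2\<^sup>T * B * V1"
    using A by (simp_all add: mat_dim_simps)
  have 4: "frob_inner (0\<^sub>m n q - B * V2) (0\<^sub>m n q - B * V2) = frob_inner (B * V2) (B * V2)"
    by (simp add: frob_inner_simps)
  show ?thesis using split rows unfolding 1 2 3 4 by linarith
qed

lemma Z_mult_S: "Z * S = U2\<^sup>T * B * V1"
  unfolding Z_eq by (simp add: mat_dim_simps T)

text \<open>The upper right block is chosen so that A21 + A12^T equals
  \<open>Y * W1\<^sup>T\<close>, and the lower right block so that the Schur complement
  vanishes.\<close>

definition candidate :: "real mat \<Rightarrow> real mat" where
  "candidate Y = from_blocks A11 ((Y * W1\<^sup>T - Z)\<^sup>T) Z ((1/4) \<cdot>\<^sub>m (Y * (E * E) * Y\<^sup>T))"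

lemma candidate_carrier [simp]: "candidate Y \<in> carrier_mat n n"
  by (simp add: candidate_def)

lemma candidate_blocks:
  assumes "Y \<in> carrier_mat p s"
  shows "U1\<^sup>T * candidate Y * U1 = A11" "U1\<^sup>T * candidate Y * U2 = (Y * W1\<^sup>T - Z)\<^sup>T"
    "U2\<^sup>T * candidate Y * U1 = Z" "U2\<^sup>T * candidate Y * U2 = (1/4) \<cdot>\<^sub>m (Y * (E * E) * Y\<^sup>T)"
proof -
  have "(Y * W1\<^sup>T - Z)\<^sup>T \<in> carrier_mat r p" "(1/4) \<cdot>\<^sub>m (Y * (E * E) * Y\<^sup>T) \<in> carrier_mat p p"
    using assms by (auto intro!: carrier_matI)
  note * = blocks_from_blocks[OF A11_carrier this(1) Z_carrier this(2)]
  show "U1\<^sup>T * candidate Y * U1 = A11" "U1\<^sup>T * candidate Y * U2 = (Y * W1\<^sup>T - Z)\<^sup>T"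
    "U2\<^sup>T * candidate Y * U1 = Z" "U2\<^sup>T * candidate Y * U2 = (1/4) \<cdot>\<^sub>m (Y * (E * E) * Y\<^sup>T)"
    unfolding candidate_def by (rule *)+
qed

text \<open>The factor 1/2 appears because the lower left block of the symmetric part is half of
  \<open>Y * W1\<^sup>T\<close>; in the mixed terms \<open>F * E = 1\<close> removes the
  roots.\<close>

definition sym_root :: "real mat \<Rightarrow> real mat" where
  "sym_root Y = U1 * W1 * F + (1/2) \<cdot>\<^sub>m (U2 * Y * E)"

lemma sym_root_carrier: "Y \<in> carrier_mat p s \<Longrightarrow> sym_root Y \<in> carrier_mat n s"
  unfolding sym_root_def by (intro carrier_matI) simp_all

text \<open>One factorization with \<open>s\<close> columns gives both feasibility and the rank
  bound.\<close>

lemma sym_part_candidate: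
  assumes Y: "Y \<in> carrier_mat p s"
  shows "sym_part (candidate Y) = sym_root Y * (sym_root Y)\<^sup>T"
proof -
  \<comment> \<open>\<open>A11\<close> enters only through its symmetric part, which is known; the
    equation is then used entry by entry.\<close>
  have "U1 * (A11 * U1\<^sup>T) + U1 * (A11\<^sup>T * U1\<^sup>T) = 2 \<cdot>\<^sub>m (U1 * sym_part A11 * U1\<^sup>T)"
    unfolding sym_part_def by (simp add: mat_dim_simps) (rule eq_matI, simp_all del: index_mult_mat(1))
  also have "\<dots> = 2 \<cdot>\<^sub>m (U1 * (W1 * (F * (F * (W1\<^sup>T * U1\<^sup>T)))))"
    unfolding sym_A11 by (simp add: mat_dim_simps)
  finally have e: "(U1 * (A11 * U1\<^sup>T)) $$ (i, j) + (U1 * (A11\<^sup>T * U1\<^sup>T)) $$ (i, j)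
      = 2 * (U1 * (W1 * (F * (F * (W1\<^sup>T * U1\<^sup>T))))) $$ (i, j)" if "i < n" "j < n" for i j
    using that by (auto dest!: arg_cong[where f = "\<lambda>M. M $$ (i, j)"] simp del: index_mult_mat(1))
  show ?thesis
  proof (rule eq_matI)
    fix i j assume "i < dim_row (sym_root Y * (sym_root Y)\<^sup>T)" "j < dim_col (sym_root Y * (sym_root Y)\<^sup>T)"
    then have "i < n" "j < n" using sym_root_carrier[OF Y] by auto
    then show "sym_part (candidate Y) $$ (i, j) = (sym_root Y * (sym_root Y)\<^sup>T) $$ (i, j)"
      using Y e[of i j] unfolding sym_part_def candidate_def from_blocks_def sym_root_def
      by (simp add: mat_dim_simps EF EF_rewrite field_simps del: index_mult_mat(1))
  qed (use sym_root_carrier[OF Y] in \<open>auto simp: sym_part_def carrier_matD[OF candidate_carrier]\<close>)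
qed

lemma candidate_psd:
  assumes "Y \<in> carrier_mat p s"
  shows "candidate Y \<in> nonsym_psd n"
  using nonsym_psd_sym_part_iff[OF candidate_carrier[of Y]] gram_nonsym_psd[OF sym_root_carrier[OF assms]]
  unfolding sym_part_candidate[OF assms] by blast

text \<open>In the split residual the first term is at least its value at \<open>A11\<close>, the
  second is at least zero, and the third is constant. A feasible matrix attaining both bounds
  exists, so every minimizer attains them.\<close>

lemma solution_iff:
  "procrustes_solution n X B A \<longleftrightarrow> A \<in> nonsym_psd n \<and> U1\<^sup>T * A * U1 = A11 \<and> U2\<^sup>T * A * U1 = Z"
proof -
  define b where "b = frob_inner (A11 * S - U1\<^sup>T * B * V1) (A11 * S - U1\<^sup>T * B * V1) + frob_inner (B * V2) (B * V2)"
  have C1: "U1\<^sup>T * B * V1 \<in> carrier_mat r r" by (intro carrier_matI) simp_all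
  have block_psd: "U1\<^sup>T * A * U1 \<in> nonsym_psd r" if "A \<in> nonsym_psd n" for A
    by (rule nonsym_psd_congruence[OF that carriers(3)])
  have A11_le: "frob_inner (A11 * S - U1\<^sup>T * B * V1) (A11 * S - U1\<^sup>T * B * V1)
      \<le> frob_inner (C * S - U1\<^sup>T * B * V1) (C * S - U1\<^sup>T * B * V1)" if "C \<in> nonsym_psd r" for C
    using A11_min that unfolding procrustes_solution_def is_arg_min_linorder fro_norm_sq by auto
  have lower: "b \<le> frob_inner (A * X - B) (A * X - B)" if A: "A \<in> nonsym_psd n" for A
    unfolding b_def residual_split[OF nonsym_psd_carrier[OF A]]
    using A11_le[OF block_psd[OF A]]
      frob_inner_self_nonneg[of "U2\<^sup>T * A * U1 * S - U2\<^sup>T * B * V1"] by linarith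
  have attained: "frob_inner (A * X - B) (A * X - B) = b"
    if A: "A \<in> nonsym_psd n" "U1\<^sup>T * A * U1 = A11" "U2\<^sup>T * A * U1 = Z" for A
    unfolding b_def residual_split[OF nonsym_psd_carrier[OF A(1)]] A(2,3) Z_mult_S
    by (simp add: frob_inner_simps)
  \<comment> \<open>\<open>Y = 0\<close> already gives a feasible matrix with the required left
    blocks.\<close>
  have ex: "frob_inner (candidate (0\<^sub>m p s) * X - B) (candidate (0\<^sub>m p s) * X - B) = b"
    by (rule attained) (simp_all add: candidate_psd candidate_blocks)
  show ?thesis
  proof (intro iffI)
    assume sol: "procrustes_solution n X B A"
    then have A: "A \<in> nonsym_psd n"
      and "frob_inner (A * X - B) (A * X - B) \<le> frob_inner (candidate (0\<^sub>m p s) * X - B) (candidate (0\<^sub>m p s) * X - B)"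
      using candidate_psd[of "0\<^sub>m p s"]
      unfolding procrustes_solution_def is_arg_min_linorder fro_norm_sq by auto
    then have le: "frob_inner (A * X - B) (A * X - B) \<le> b" unfolding ex by simp
    note split = residual_split[OF nonsym_psd_carrier[OF A]]
    let ?R = "U2\<^sup>T * A * U1 * S - U2\<^sup>T * B * V1"
    \<comment> \<open>The first residual cannot drop below its value at \<open>A11\<close>, so the
      second has nothing left.\<close>
    have "frob_inner ?R ?R \<le> 0"
      using le A11_le[OF block_psd[OF A]] unfolding b_def split by argo
    then have "frob_inner ?R ?R = 0" using frob_inner_self_nonneg by (intro antisym)
    then have "?R = 0\<^sub>m p r" using frob_inner_self_eq_0[of ?R] by simp
    then have "U2\<^sup>T * A * U1 * S = U2\<^sup>T * B * V1"
      by (rule minus_eq_zero_mat) (auto intro!: carrier_matI)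
    then have "U2\<^sup>T * A * U1 * S * T = Z" unfolding Z_eq by simp
    then have "U2\<^sup>T * A * U1 = Z"
      using nonsym_psd_carrier[OF A] by (simp add: mult_assoc_dim T mult_one_dim)
    moreover have "U1\<^sup>T * A * U1 = A11"
    proof (rule procrustes_solution_unique[OF carriers(7,8) T(1) C1 A11_min block_psd[OF A]])
      show "frob_inner (U1\<^sup>T * A * U1 * S - U1\<^sup>T * B * V1) (U1\<^sup>T * A * U1 * S - U1\<^sup>T * B * V1)
        \<le> frob_inner (A11 * S - U1\<^sup>T * B * V1) (A11 * S - U1\<^sup>T * B * V1)"
        using le frob_inner_self_nonneg[of ?R] unfolding b_def split by argo
    qed
    ultimately show "A \<in> nonsym_psd n \<and> U1\<^sup>T * A * U1 = A11 \<and> U2\<^sup>T * A * U1 = Z" using A by simp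
  next
    assume "A \<in> nonsym_psd n \<and> U1\<^sup>T * A * U1 = A11 \<and> U2\<^sup>T * A * U1 = Z"
    then show "procrustes_solution n X B A"
      unfolding procrustes_solution_def is_arg_min_linorder fro_norm_sq
      using lower attained by simp
  qed
qed

end

section \<open>What positivity imposes on a minimizer\<close>

context procrustes_frame
begin

context
  fixes A :: "real mat"
  assumes A_psd: "A \<in> nonsym_psd n" and A_11: "U1\<^sup>T * A * U1 = A11" and A_21: "U2\<^sup>T * A * U1 = Z"
begin

text \<open>Twice the lower left block of the symmetric part of \<open>A\<close> in the frame
  \<open>(U1 U2)\<close>.\<close>

definition coupling :: "real mat" where
  "coupling = Z + (U1\<^sup>T * A * U2)\<^sup>T"

lemma A_carrier: "A \<in> carrier_mat n n"
  by (rule nonsym_psd_carrier[OF A_psd])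

lemma A_dims [simp]: "dim_row A = n" "dim_col A = n" "dim_row coupling = p" "dim_col coupling = r"
  using A_carrier by (simp_all add: coupling_def)

text \<open>Test \<open>A\<close> with \<open>U1 * u + U2 * v\<close>: the mixed terms merge into
  \<open>coupling\<close>, and \<open>A11\<close> acts only through its symmetric part.\<close>

lemma quadratic_form_nonneg:
  assumes u: "u \<in> carrier_mat r k" and v: "v \<in> carrier_mat p k"
  shows "0 \<le> frob_inner u (W1 * (F * F) * W1\<^sup>T * u) + frob_inner v (coupling * u)
    + frob_inner v (U2\<^sup>T * A * U2 * v)"
proof -
  have [simp]: "dim_row u = r" "dim_col u = k" "dim_row v = p" "dim_col v = k" using u v by auto
  have "U1 * u + U2 * v \<in> carrier_mat n k" by (intro carrier_matI) simp_all
  then have "0 \<le> frob_inner (U1 * u + U2 * v) (A * (U1 * u + U2 * v))" by (rule nonsym_psdD[OF A_psd])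
  also have "\<dots> = frob_inner u (U1\<^sup>T * (A * (U1 * u))) + frob_inner u (U1\<^sup>T * (A * (U2 * v)))
      + frob_inner v (U2\<^sup>T * (A * (U1 * u))) + frob_inner v (U2\<^sup>T * (A * (U2 * v)))"
    by (simp add: mult_add_dim frob_inner_simps frob_inner_mult_left)
  also have "U1\<^sup>T * (A * (U1 * u)) = A11 * u" unfolding A_11[symmetric] by (simp add: mult_assoc_dim)
  also have "U2\<^sup>T * (A * (U1 * u)) = Z * u" unfolding A_21[symmetric] by (simp add: mult_assoc_dim)
  \<comment> \<open>Transposition brings this mixed term to the same shape as the one with
    \<open>Z\<close>.\<close>
  also have "frob_inner u (U1\<^sup>T * (A * (U2 * v))) = frob_inner v ((U1\<^sup>T * A * U2)\<^sup>T * u)"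
  proof -
    have "frob_inner u (U1\<^sup>T * (A * (U2 * v))) = frob_inner ((U1\<^sup>T * A * U2) * v) u"
      by (simp add: mult_assoc_dim frob_inner_commute)
    also have "\<dots> = frob_inner v ((U1\<^sup>T * A * U2)\<^sup>T * u)"
      by (rule frob_inner_mult_left) simp_all
    finally show ?thesis .
  qed
  also have "frob_inner u (A11 * u) = frob_inner u (W1 * (F * F) * W1\<^sup>T * u)"
    using frob_inner_sym_part[OF A11_carrier u] unfolding sym_A11[symmetric] sym_part_def
    by (simp add: smult_mult_dim frob_inner_smult_right)
  finally show ?thesis
    unfolding coupling_def by (simp add: add_mult_dim frob_inner_add_right mult_assoc_dim)
qed

text \<open>Along the kernel of \<open>H\<^sub>1\<^sub>1\<close> the form is affine in \<open>u\<close>, so its linear part must vanish there.\<close>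

lemma coupling_mult_W2: "coupling * W2 = 0\<^sub>m p t"
proof -
  let ?M = "coupling * W2"
  let ?c = "frob_inner (1\<^sub>m p) (U2\<^sup>T * A * U2 * 1\<^sub>m p)"
  have bound: "\<tau> * frob_inner ?M ?M \<le> ?c" for \<tau> :: real
  proof -
    \<comment> \<open>The columns of \<open>W2\<close> kill the quadratic term, and against
      \<open>v = 1\<close> the mixed term becomes -\<tau> times the squared norm of
      \<open>?M\<close>.\<close>
    let ?u = "(- \<tau>) \<cdot>\<^sub>m (W2 * ?M\<^sup>T)"
    have u: "?u \<in> carrier_mat r p" by (intro carrier_matI) simp_all
    have "W1 * (F * F) * W1\<^sup>T * ?u = (- \<tau>) \<cdot>\<^sub>m 0\<^sub>m r p"
      by (simp add: mult_assoc_dim mult_smult_dim W_rewrite zero_mult_dim mult_zero_dim W)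
    then have 1: "frob_inner ?u (W1 * (F * F) * W1\<^sup>T * ?u) = 0" by (simp add: frob_inner_simps)
    have "coupling * ?u = (- \<tau>) \<cdot>\<^sub>m (?M * ?M\<^sup>T)" by (simp add: mult_assoc_dim mult_smult_dim)
    moreover have "frob_inner (1\<^sub>m p) (?M * ?M\<^sup>T) = frob_inner ?M ?M"
      using frob_inner_mult_right[of "1\<^sub>m p" ?M ?M] by (simp add: one_mult_dim)
    ultimately have 2: "frob_inner (1\<^sub>m p) (coupling * ?u) = - \<tau> * frob_inner ?M ?M"
      by (simp add: frob_inner_smult_right)
    show ?thesis using quadratic_form_nonneg[OF u one_carrier_mat] unfolding 1 2 by linarith
  qed
  have "frob_inner ?M ?M = 0"
  proof (rule ccontr)
    assume "frob_inner ?M ?M \<noteq> 0"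
    \<comment> \<open>This \<tau> makes the left side of \<open>bound\<close> equal to
      \<open>?c + 1\<close>.\<close>
    then show False using bound[of "(?c + 1) / frob_inner ?M ?M"] by simp
  qed
  then show ?thesis using frob_inner_self_eq_0[of ?M] by simp
qed

text \<open>The parameter \<open>Y\<close> that belongs to a given minimizer.\<close>

definition reduced :: "real mat" where
  "reduced = coupling * W1"

lemma reduced_carrier: "reduced \<in> carrier_mat p s"
  unfolding reduced_def by (intro carrier_matI) simp_all

lemma coupling_eq: "coupling = reduced * W1\<^sup>T"
proof -
  have "coupling = coupling * (W1 * W1\<^sup>T + W2 * W2\<^sup>T)" unfolding W_complete by (simp add: mult_one_dim)
  also have "\<dots> = reduced * W1\<^sup>T + coupling * W2 * W2\<^sup>T"
    unfolding reduced_def by (simp add: mult_add_dim mult_assoc_dim)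
  also have "\<dots> = reduced * W1\<^sup>T"
    unfolding coupling_mult_W2 by (simp add: zero_mult_dim add_zero_dim reduced_def)
  finally show ?thesis .
qed

lemma upper_block_eq: "U1\<^sup>T * A * U2 = (reduced * W1\<^sup>T - Z)\<^sup>T"
  unfolding coupling_eq[symmetric] coupling_def by (rule eq_matI) (simp_all del: index_mult_mat(1))

text \<open>The test direction \<open>u = -1/2 W\<^sub>1 \<Lambda>\<^sup>-\<^sup>1 Y\<^sup>T v\<close> minimises the form over \<open>u\<close> for fixed \<open>v\<close>.\<close>

lemma schur_complement_psd:
  "U2\<^sup>T * A * U2 - (1/4) \<cdot>\<^sub>m (reduced * (E * E) * reduced\<^sup>T) \<in> nonsym_psd p"
  unfolding nonsym_psd_iff
proof (intro conjI allI ballI)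
  note [simp] = carrier_matD[OF reduced_carrier]
  show "U2\<^sup>T * A * U2 - (1/4) \<cdot>\<^sub>m (reduced * (E * E) * reduced\<^sup>T) \<in> carrier_mat p p"
    by (intro carrier_matI) simp_all
  fix k and v :: "real mat" assume v: "v \<in> carrier_mat p k"
  \<comment> \<open>All terms become multiples of the squared norm of \<open>?w\<close>: 1/4 from
    the quadratic part and -1/2 from the mixed part add up to the -1/4 of the Schur
    correction.\<close>
  let ?w = "E * (reduced\<^sup>T * v)"
  let ?u = "(- (1/2)) \<cdot>\<^sub>m (W1 * (E * ?w))"
  have u: "?u \<in> carrier_mat r k" using v by (intro carrier_matI) simp_all
  have "frob_inner ?u (W1 * (F * F) * W1\<^sup>T * ?u) = 1/4 * frob_inner ?w ?w"
  proof -
    have "frob_inner ?u (W1 * (F * F) * W1\<^sup>T * ?u)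
      = 1/4 * frob_inner (W1 * (E * ?w)) (W1 * (F * (F * (W1\<^sup>T * (W1 * (E * ?w))))))"
      using v by (simp add: mult_assoc_dim mult_smult_dim frob_inner_simps)
    also have "W1 * (F * (F * (W1\<^sup>T * (W1 * (E * ?w))))) = W1 * (F * ?w)"
      using v by (simp add: W_rewrite EF_rewrite one_mult_dim)
    also have "frob_inner (W1 * (E * ?w)) (W1 * (F * ?w)) = frob_inner ?w ?w"
      using v by (simp add: frob_inner_mult_left[of W1] frob_inner_mult_left[of E "E * (reduced\<^sup>T * v)"]
          W_rewrite EF EF_rewrite one_mult_dim)
    finally show ?thesis .
  qed
  moreover have "frob_inner v (coupling * ?u) = - (1/2) * frob_inner v (reduced * (E * ?w))"
    unfolding coupling_eq using v
    by (simp add: mult_assoc_dim mult_smult_dim frob_inner_smult_right W_rewrite one_mult_dim)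
  moreover have "frob_inner v (reduced * (E * ?w)) = frob_inner ?w ?w"
  proof -
    have "frob_inner ?w ?w = frob_inner (reduced\<^sup>T * v) (E * ?w)"
      using v frob_inner_mult_left[of E "reduced\<^sup>T * v" ?w] by (simp add: EF)
    also have "\<dots> = frob_inner v (reduced * (E * ?w))"
      using v frob_inner_mult_left[of "reduced\<^sup>T" v "E * ?w"] by simp
    finally show ?thesis by simp
  qed
  moreover have "frob_inner v ((U2\<^sup>T * A * U2 - (1/4) \<cdot>\<^sub>m (reduced * (E * E) * reduced\<^sup>T)) * v)
    = frob_inner v (U2\<^sup>T * A * U2 * v) - 1/4 * frob_inner v (reduced * (E * ?w))"
    using v by (simp add: minus_mult_dim smult_mult_dim mult_assoc_dim frob_inner_simps)
  ultimately show "0 \<le> frob_inner v ((U2\<^sup>T * A * U2 - (1/4) \<cdot>\<^sub>m (reduced * (E * E) * reduced\<^sup>T)) * v)"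
    using quadratic_form_nonneg[OF u v] by argo
qed

end

section \<open>The minimizer of least norm\<close>

definition objective :: "real mat \<Rightarrow> real" where
  "objective Y = frob_inner (Y * W1\<^sup>T - Z) (Y * W1\<^sup>T - Z)
    + 1/16 * frob_inner (Y * (E * E) * Y\<^sup>T) (Y * (E * E) * Y\<^sup>T)"

lemma frob_inner_transpose_self: "frob_inner (N\<^sup>T) (N\<^sup>T) = frob_inner N N"
  by (rule frob_inner_transpose) simp_all

text \<open>The left blocks do not depend on \<open>Y\<close>; the weight 1/16 is the square of the
  1/4 in the lower right block.\<close>

lemma frob_inner_candidate:
  assumes "Y \<in> carrier_mat p s"
  shows "frob_inner (candidate Y) (candidate Y) = frob_inner A11 A11 + frob_inner Z Z + objective Y"
  unfolding frob_inner_blocks[OF candidate_carrier] candidate_blocks[OF assms] objective_def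
    frob_inner_transpose_self
  by (simp add: frob_inner_smult_left frob_inner_smult_right)

text \<open>Write the lower right block as \<open>Q + P\<close> with \<open>P\<close> in the cone.
  The mixed term is nonnegative, so the norm is at least that of the candidate with the same
  \<open>Y\<close>, and equality forces \<open>P = 0\<close>.\<close>

lemma frob_inner_solution_ge:
  assumes A: "procrustes_solution n X B A"
  obtains Y where "Y \<in> carrier_mat p s"
    "frob_inner A11 A11 + frob_inner Z Z + objective Y \<le> frob_inner A A"
    "frob_inner A A \<le> frob_inner A11 A11 + frob_inner Z Z + objective Y \<Longrightarrow> A = candidate Y"
proof -
  have sol: "A \<in> nonsym_psd n" "U1\<^sup>T * A * U1 = A11" "U2\<^sup>T * A * U1 = Z"
    using A by (simp_all add: solution_iff)
  have A_carrier: "A \<in> carrier_mat n n" by (rule nonsym_psd_carrier[OF sol(1)])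
  define Y where "Y = reduced A"
  have Y: "Y \<in> carrier_mat p s" unfolding Y_def by (rule reduced_carrier[OF sol])
  define Q where "Q = (1/4) \<cdot>\<^sub>m (Y * (E * E) * Y\<^sup>T)"
  define P where "P = U2\<^sup>T * A * U2 - Q"
  have P: "P \<in> nonsym_psd p"
    unfolding P_def Q_def Y_def by (rule schur_complement_psd[OF sol])
  note P_carrier = nonsym_psd_carrier[OF P]
  have Q_carrier: "Q \<in> carrier_mat p p" unfolding Q_def using Y by (intro carrier_matI) simp_all
  have A22: "U2\<^sup>T * A * U2 = Q + P"
    unfolding P_def using Q_carrier A_carrier by (intro eq_matI) (simp_all del: index_mult_mat(1))
  have YE: "Y * E \<in> carrier_mat p s" using Y by (intro carrier_matI) simp_all
  have gram: "Y * (E * E) * Y\<^sup>T = (Y * E) * (Y * E)\<^sup>T"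
    using Y by (simp add: mult_assoc_dim transpose_mult_dim EF)
  have "0 \<le> frob_inner Q P"
    unfolding Q_def gram frob_inner_smult_left
    using frob_inner_gram_nonneg[OF YE P] by (intro mult_nonneg_nonneg) auto
  then have "frob_inner Q Q + frob_inner P P \<le> frob_inner (U2\<^sup>T * A * U2) (U2\<^sup>T * A * U2)"
    unfolding A22 using P_carrier Q_carrier frob_inner_commute[of P Q]
    by (simp add: frob_inner_simps)
  moreover have "frob_inner Q Q = 1/16 * frob_inner (Y * (E * E) * Y\<^sup>T) (Y * (E * E) * Y\<^sup>T)"
    unfolding Q_def by (simp add: frob_inner_smult_left frob_inner_smult_right)
  moreover have upper: "U1\<^sup>T * A * U2 = (Y * W1\<^sup>T - Z)\<^sup>T"
    unfolding Y_def by (rule upper_block_eq[OF sol])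
  \<comment> \<open>The term in \<open>P\<close> is kept because it decides the equality
    case.\<close>
  ultimately have ge: "frob_inner A11 A11 + frob_inner Z Z + objective Y + frob_inner P P \<le> frob_inner A A"
    unfolding frob_inner_blocks[OF A_carrier] sol(2,3) objective_def
    by (simp add: frob_inner_transpose_self)
  show thesis
  proof (rule that[OF Y])
    show "frob_inner A11 A11 + frob_inner Z Z + objective Y \<le> frob_inner A A"
      using ge frob_inner_self_nonneg[of P] by linarith
    assume "frob_inner A A \<le> frob_inner A11 A11 + frob_inner Z Z + objective Y"
    then have "frob_inner P P = 0" using ge frob_inner_self_nonneg[of P] by linarith
    then have "P = 0\<^sub>m p p" using frob_inner_self_eq_0[of P] P_carrier by simp
    then have "U2\<^sup>T * A * U2 = Q" unfolding A22 using Q_carrier by (simp add: add_zero_dim)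
    then show "A = candidate Y"
      using from_blocks_blocks[OF A_carrier] unfolding sol(2,3) upper candidate_def Q_def by simp
  qed
qed

lemma objective_unique_minimizer:
  obtains L where "L \<in> carrier_mat p s" "\<And>Y. Y \<in> carrier_mat p s \<Longrightarrow> objective L \<le> objective Y"
    "\<And>Y. Y \<in> carrier_mat p s \<Longrightarrow> objective Y \<le> objective L \<Longrightarrow> Y = L"
  using quartic_objective_unique_minimizer[OF carriers(9) W(1) Z_carrier carriers(12) EF(2)]
  unfolding objective_def by blast

lemma candidate_solution:
  assumes "Y \<in> carrier_mat p s"
  shows "procrustes_solution n X B (candidate Y)"
  by (simp add: solution_iff candidate_psd[OF assms] candidate_blocks[OF assms])

text \<open>Two comparisons are chained, from \<open>A\<close> to the candidate with its own
  \<open>Y\<close> and from there to \<open>L\<close>; equality throughout forces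
  \<open>Y = L\<close> and then \<open>A = candidate L\<close>.\<close>

lemma candidate_least_norm:
  assumes L: "L \<in> carrier_mat p s"
    and min: "\<And>Y. Y \<in> carrier_mat p s \<Longrightarrow> objective L \<le> objective Y"
    and uniq: "\<And>Y. Y \<in> carrier_mat p s \<Longrightarrow> objective Y \<le> objective L \<Longrightarrow> Y = L"
    and A: "procrustes_solution n X B A"
  shows "fro_norm (candidate L) \<le> fro_norm A"
    and "fro_norm A \<le> fro_norm (candidate L) \<Longrightarrow> A = candidate L"
proof -
  obtain Y where Y: "Y \<in> carrier_mat p s"
    and ge: "frob_inner A11 A11 + frob_inner Z Z + objective Y \<le> frob_inner A A"
    and eq: "frob_inner A A \<le> frob_inner A11 A11 + frob_inner Z Z + objective Y \<Longrightarrow> A = candidate Y"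
    using frob_inner_solution_ge[OF A] by blast
  show "fro_norm (candidate L) \<le> fro_norm A"
    unfolding fro_norm_le_iff frob_inner_candidate[OF L] using ge min[OF Y] by linarith
  assume "fro_norm A \<le> fro_norm (candidate L)"
  then have le: "frob_inner A A \<le> frob_inner A11 A11 + frob_inner Z Z + objective L"
    unfolding fro_norm_le_iff frob_inner_candidate[OF L] .
  then have "Y = L" using ge by (intro uniq[OF Y]) linarith
  then show "A = candidate L" using eq le by simp
qed

section \<open>Ranks of the symmetric and skew-symmetric parts\<close>

lemma rank_sym_part_candidate_le:
  assumes Y: "Y \<in> carrier_mat p s"
  shows "vec_space.rank n (sym_part (candidate Y)) \<le> s"
  unfolding sym_part_candidate[OF Y]
  by (rule vec_space.rank_mult_le_dim[OF sym_root_carrier[OF Y]])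
    (use sym_root_carrier[OF Y] in simp)

text \<open>Compression by \<open>U1\<close> sends the symmetric part of \<open>A\<close> to that of
  \<open>A11\<close>, and multiplication on either side cannot raise the rank.\<close>

lemma rank_sym_part_solution_ge:
  assumes A: "procrustes_solution n X B A"
  shows "vec_space.rank r (sym_part A11) \<le> vec_space.rank n (sym_part A)"
proof -
  have sol: "A \<in> carrier_mat n n" "U1\<^sup>T * A * U1 = A11"
    using A nonsym_psd_carrier by (auto simp: solution_iff)
  have c: "sym_part A \<in> carrier_mat n n" using sol by (simp add: sym_part_def)
  have "sym_part A11 = U1\<^sup>T * sym_part A * U1"
    unfolding sol(2)[symmetric] sym_part_def using sol(1) by (simp add: mat_dim_simps)
  also have "vec_space.rank r \<dots> \<le> vec_space.rank r (U1\<^sup>T * sym_part A)"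
    using c carriers(3) by (intro vec_space.rank_mult_le_left) auto
  also have "\<dots> \<le> vec_space.rank n (sym_part A)"
    using c carriers(3) by (intro rank_mult_le_right) auto
  finally show ?thesis .
qed

text \<open>The lower right block is symmetric and drops out. What remains splits into a term with
  left factor \<open>U1\<close> and one with right factor \<open>U1\<^sup>T\<close>, each of rank at
  most \<open>r\<close>.\<close>

lemma rank_skew_part_candidate_le:
  assumes Y: "Y \<in> carrier_mat p s"
  shows "vec_space.rank n (skew_part (candidate Y)) \<le> 2 * r"
proof -
  \<comment> \<open>This is A12^T - A21, since A21 is \<open>Z\<close> and A12^T is
    \<open>Y * W1\<^sup>T - Z\<close>.\<close>
  define J where "J = Y * W1\<^sup>T - 2 \<cdot>\<^sub>m Z"
  define N1 where "N1 = (1/2) \<cdot>\<^sub>m ((A11 - A11\<^sup>T) * U1\<^sup>T + J\<^sup>T * U2\<^sup>T)"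
  define N2 where "N2 = (- (1/2)) \<cdot>\<^sub>m (U2 * J)"
  have J [simp]: "dim_row J = p" "dim_col J = r" unfolding J_def using Y by simp_all
  have U1T: "U1\<^sup>T \<in> carrier_mat r n" using carriers(3) by simp
  have N: "N1 \<in> carrier_mat r n" "N2 \<in> carrier_mat n r"
    unfolding N1_def N2_def by (auto intro!: carrier_matI)
  have "skew_part (candidate Y) = U1 * N1 + N2 * U1\<^sup>T"
  proof (rule eq_matI)
    fix i j assume "i < dim_row (U1 * N1 + N2 * U1\<^sup>T)" "j < dim_col (U1 * N1 + N2 * U1\<^sup>T)"
    then have "i < n" "j < n" using N by auto
    then show "skew_part (candidate Y) $$ (i, j) = (U1 * N1 + N2 * U1\<^sup>T) $$ (i, j)"
      using Y unfolding skew_part_def candidate_def from_blocks_def N1_def N2_def J_def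
      by (simp add: mat_dim_simps EF field_simps del: index_mult_mat(1))
  qed (use N in \<open>auto simp: skew_part_def carrier_matD[OF candidate_carrier]\<close>)
  also have "vec_space.rank n \<dots> \<le> vec_space.rank n (U1 * N1) + vec_space.rank n (N2 * U1\<^sup>T)"
    by (rule vec_space.rank_subadditive[OF mult_carrier_mat[OF carriers(3) N(1)] mult_carrier_mat[OF N(2) U1T]])
  also have "\<dots> \<le> r + r"
    using vec_space.rank_mult_le_dim[OF carriers(3) N(1)] vec_space.rank_mult_le_dim[OF N(2) U1T]
    by (rule add_mono)
  finally show ?thesis by simp
qed

end

section \<open>From the block decompositions to the final statement\<close>

lemma block_svd_product:
  assumes "block_svd n m r X U1 U2 S V1 V2"
  shows "X = U1 * S * V1\<^sup>T"
proof -
  have c: "U1 \<in> carrier_mat n r" "U2 \<in> carrier_mat n (n - r)" "V1 \<in> carrier_mat m r"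
    "V2 \<in> carrier_mat m (m - r)" "S \<in> carrier_mat r r"
    and X: "X = hcat U1 U2
      * four_block_mat S (0\<^sub>m r (m - r)) (0\<^sub>m (n - r) r) (0\<^sub>m (n - r) (m - r)) * (hcat V1 V2)\<^sup>T"
    using assms unfolding block_svd_def by blast+
  show ?thesis
    unfolding X using c
    by (subst hcat_block_transpose[OF c(1) c(2) c(3) c(4) c(5)])
      (simp_all add: mult_zero_dim zero_mult_dim add_zero_dim)
qed

theorem theorem3p4:
  fixes n m r s :: nat
    and X B U1 U2 \<Sigma>1 V1 V2 A11 H11 Z W1 W2 \<Lambda> :: "real mat"
  assumes X: "X \<in> carrier_mat n m"
    and B: "B \<in> carrier_mat n m"
    and svd_X: "block_svd n m r X U1 U2 \<Sigma>1 V1 V2"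
    and A11: "procrustes_solution r \<Sigma>1 (U1\<^sup>T * B * V1) A11"
    and H11: "H11 = sym_part A11"
    and Z: "Z = U2\<^sup>T * B * V1 * mat_inv \<Sigma>1"
    and svd_H11: "block_svd r r s H11 W1 W2 \<Lambda> W1 W2"
  shows "\<exists>Y. let U = hcat U1 U2;
                 feasible = (\<lambda>Y'. Y' \<in> carrier_mat (n - r) s);
                 objective = (\<lambda>Y'. (fro_norm (Y' * W1\<^sup>T - Z))\<^sup>2
                               + 1/16 * (fro_norm (Y' * mat_inv \<Lambda> * Y'\<^sup>T))\<^sup>2);
                 A = U * four_block_mat A11 ((Y * W1\<^sup>T - Z)\<^sup>T)
                                        Z   ((1/4) \<cdot>\<^sub>m (Y * mat_inv \<Lambda> * Y\<^sup>T)) * U\<^sup>T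
             in is_arg_min objective feasible Y
              \<and> (\<forall>Y'. is_arg_min objective feasible Y' \<longrightarrow> Y' = Y)
              \<and> is_arg_min fro_norm (procrustes_solution n X B) A
              \<and> (\<forall>A'. is_arg_min fro_norm (procrustes_solution n X B) A' \<longrightarrow> A' = A)
              \<and> vec_space.rank n (sym_part A) = s
              \<and> is_arg_min (\<lambda>A'. vec_space.rank n (sym_part A')) (procrustes_solution n X B) A
              \<and> vec_space.rank n (skew_part A) \<le> 2 * r"
proof -
  have U1: "U1 \<in> carrier_mat n r" and U2: "U2 \<in> carrier_mat n (n - r)"
    and V1: "V1 \<in> carrier_mat m r" and V2: "V2 \<in> carrier_mat m (m - r)"
    and \<Sigma>1: "\<Sigma>1 \<in> carrier_mat r r" "diagonal_mat \<Sigma>1" "\<forall>i<r. 0 < \<Sigma>1 $$ (i, i)"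
    and oU: "orthonormal_mat n (hcat U1 U2)" and oV: "orthonormal_mat m (hcat V1 V2)"
    using svd_X unfolding block_svd_def by blast+
  have W1: "W1 \<in> carrier_mat r s" and W2: "W2 \<in> carrier_mat r (r - s)"
    and \<Lambda>: "\<Lambda> \<in> carrier_mat s s" "diagonal_mat \<Lambda>" "\<forall>i<s. 0 < \<Lambda> $$ (i, i)"
    and oW: "orthonormal_mat r (hcat W1 W2)" and s: "s = vec_space.rank r H11"
    using svd_H11 unfolding block_svd_def by blast+
  obtain F0 E0 where FE0: "F0 \<in> carrier_mat r r" "E0 \<in> carrier_mat r r" "\<Sigma>1 = F0 * F0"
    "E0 * F0 = 1\<^sub>m r" "F0 * E0 = 1\<^sub>m r" "mat_inv \<Sigma>1 = E0 * E0"
    using positive_diagonal_roots[OF \<Sigma>1] by metis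
  obtain F E where FE: "F \<in> carrier_mat s s" "E \<in> carrier_mat s s" "F\<^sup>T = F" "E\<^sup>T = E"
    "\<Lambda> = F * F" "E * F = 1\<^sub>m s" "F * E = 1\<^sub>m s" "mat_inv \<Lambda> = E * E"
    using positive_diagonal_roots[OF \<Lambda>] by metis
  have inv: "\<Sigma>1 * (E0 * E0) = 1\<^sub>m r" "(E0 * E0) * \<Sigma>1 = 1\<^sub>m r"
    using FE0(1,2) unfolding FE0(3)
    by (simp_all add: mult_assoc_dim mult_assoc_rewrite[OF FE0(4)] mult_assoc_rewrite[OF FE0(5)]
        one_mult_dim FE0(4,5))
  have H11_eq: "sym_part A11 = W1 * (F * F) * W1\<^sup>T"
    using block_svd_product[OF svd_H11] unfolding H11 FE(5) .
  \<comment> \<open>Here \<open>n - r\<close>, \<open>m - r\<close>, \<open>r - s\<close> become the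
    free dimensions of the frame, and \<open>E0 * E0\<close> is the inverse of
    \<open>\<Sigma>1\<close>.\<close>
  interpret procrustes_frame n m r "n - r" "m - r" s "r - s" X B U1 U2 \<Sigma>1 "E0 * E0" V1 V2 A11 Z W1 W2 F E
  proof (rule procrustes_frame.intro)
    show "E0 * E0 \<in> carrier_mat r r" by (rule mult_carrier_mat[OF FE0(2,2)])
    show "Z = U2\<^sup>T * B * V1 * (E0 * E0)" using Z unfolding FE0(6) .
  qed (fact X B U1 U2 V1 V2 \<Sigma>1(1) W1 W2 FE inv A11 H11_eq block_svd_product[OF svd_X]
      orthonormal_hcatD[OF oU U1 U2] orthonormal_hcatD[OF oV V1 V2] orthonormal_hcatD[OF oW W1 W2])+
  have objective_eq: "(fro_norm (Y * W1\<^sup>T - Z))\<^sup>2 + 1/16 * (fro_norm (Y * mat_inv \<Lambda> * Y\<^sup>T))\<^sup>2 = objective Y" for Y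
    unfolding objective_def fro_norm_sq FE(8) ..
  have candidate_eq: "hcat U1 U2 * four_block_mat A11 ((Y * W1\<^sup>T - Z)\<^sup>T) Z
      ((1/4) \<cdot>\<^sub>m (Y * mat_inv \<Lambda> * Y\<^sup>T)) * (hcat U1 U2)\<^sup>T = candidate Y"
    if Y: "Y \<in> carrier_mat (n - r) s" for Y
  proof -
    have c: "(Y * W1\<^sup>T - Z)\<^sup>T \<in> carrier_mat r (n - r)"
      "(1/4) \<cdot>\<^sub>m (Y * (E * E) * Y\<^sup>T) \<in> carrier_mat (n - r) (n - r)"
      using Y by (auto intro!: carrier_matI)
    show ?thesis
      unfolding FE(8) candidate_def from_blocks_def
        hcat_block_transpose[OF U1 U2 U1 U2 A11_carrier c(1) Z_carrier c(2)]
      using Y by (intro eq_matI) (simp_all add: add_mult_dim del: index_mult_mat(1))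
  qed
  obtain L where L: "L \<in> carrier_mat (n - r) s"
    and min: "\<And>Y. Y \<in> carrier_mat (n - r) s \<Longrightarrow> objective L \<le> objective Y"
    and uniq: "\<And>Y. Y \<in> carrier_mat (n - r) s \<Longrightarrow> objective Y \<le> objective L \<Longrightarrow> Y = L"
    using objective_unique_minimizer by blast
  note least = candidate_least_norm[OF L min uniq]
  \<comment> \<open>\<open>block_svd\<close> fixes \<open>s\<close> as the rank of
    \<open>H11\<close>, so the compression bound becomes a bound by \<open>s\<close>.\<close>
  have rank_ge: "s \<le> vec_space.rank n (sym_part A)" if "procrustes_solution n X B A" for A
    using rank_sym_part_solution_ge[OF that] unfolding s H11 .
  have rank_eq: "vec_space.rank n (sym_part (candidate L)) = s"
    using rank_sym_part_candidate_le[OF L] rank_ge[OF candidate_solution[OF L]] by (rule antisym)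
  show ?thesis
    unfolding Let_def objective_eq
  proof (intro exI[of _ L], unfold candidate_eq[OF L], intro conjI allI impI)
    show "is_arg_min objective (\<lambda>Y'. Y' \<in> carrier_mat (n - r) s) L"
      using L min by (simp add: is_arg_min_linorder)
    show "Y' = L" if "is_arg_min objective (\<lambda>Y'. Y' \<in> carrier_mat (n - r) s) Y'" for Y'
      using that L by (intro uniq) (auto simp: is_arg_min_linorder)
    show "is_arg_min fro_norm (procrustes_solution n X B) (candidate L)"
      using candidate_solution[OF L] least(1) by (simp add: is_arg_min_linorder)
    show "A' = candidate L" if "is_arg_min fro_norm (procrustes_solution n X B) A'" for A'
      using that candidate_solution[OF L] by (intro least(2)) (auto simp: is_arg_min_linorder)
    show "vec_space.rank n (sym_part (candidate L)) = s" by (rule rank_eq)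
    show "is_arg_min (\<lambda>A'. vec_space.rank n (sym_part A')) (procrustes_solution n X B) (candidate L)"
      using candidate_solution[OF L] rank_ge by (simp add: is_arg_min_linorder rank_eq)
    show "vec_space.rank n (skew_part (candidate L)) \<le> 2 * r"
      by (rule rank_skew_part_candidate_le[OF L])
  qed
qed

end
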